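(* Consider a dominated observation-driven model $(g,\psi)$ with kernels $G$, $K$, $R$ as described in the context. Assume the following. (a) $(\mathsf X,d)$ is a locally compact, complete and separable metric space and $\mathcal X$ is its Borel $\sigma$-field. (b) There exist $(\lambda,\beta)\in(0,1)\times\mathbb R_+$ and a measurable function $V:\mathsf X\to\mathbb R_+$ such that $RV\le\lambda V+\beta$ and $\{V\le M\}$ is compact for any $M>0$. (c) $R$ is weak Feller: for any continuous and bounded function $f$ on $\mathsf X$, $Rf$ is continuous and bounded on $\mathsf X$. (d) $R$ has a reachable point: there exists $x_0\in\mathsf X$ such that, for any $x\in\mathsf X$ and any neighborhood $\mathcal N$ of $x_0$, $R^m(x;\mathcal N)>0$ for at least one positive integer $m$. (e) $\displaystyle\sup_{(x,x',y)\in\mathsf X^2\times\mathsf Y,\ x\ne x'}\frac{d(\psi_y(x),\psi_y(x'))}{d(x,x')}<1$. (f) There exist measurable functions $\alpha:\mathsf X^2\to[0,1]$, $\phi:\mathsf X^2\to\mathsf X$ and $W:\mathsf X^2\to[1,\infty)$ such that: (i) for all $(x,x')\in\mathsf X^2$ and $y\in\mathsf Y$, $\min\{g(x;y),g(x';y)\}\ge\alpha(x,x')\,g(\phi(x,x');y)$; (ii) for all $x\in\mathsf X$, there exists $\gamma_x>0$ such that $\sup_{x'\in\mathsf B(x,\gamma_x)}W(x,x')<\infty$, where $\mathsf B(x,\gamma_x)$ is the ball of center $x$ and radius $\gamma_x$; (iii) for all $(x,x')\in\mathsf X^2$, $1-\alpha(x,x')\le d(x,x')\,W(x,x')$; (iv)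 $\displaystyle\sup_{(x,x')\in\mathsf X^2}\left(\int_{\mathsf Y}W(\psi_y(x),\psi_y(x'))\,G(\phi(x,x');dy)-W(x,x')\right)<\infty$. Then $K$ admits a unique stationary distribution $\pi$ on $\mathsf X\times\mathsf Y$. Moreover, denoting by $\pi_1$ the marginal of $\pi$ on $\mathsf X$, $\pi_1(\bar V)<\infty$ for every measurable $\bar V:\mathsf X\to\mathbb R_+$ such that $\bar V\lesssim V$.
   Context: $\mathbb R_+=[0,\infty)$. $(\mathsf X,d)$ is a complete separable metric space with Borel $\sigma$-field $\mathcal X$; $(\mathsf Y,\mathcal Y)$ is a (standard) Borel space. $G$ is a probability kernel on $\mathsf X\times\mathcal Y$ dominated by a $\sigma$-finite measure $\nu$ on $(\mathsf Y,\mathcal Y)$: $G(x;dy)=g(x;y)\,\nu(dy)$ with $g(x;y)>0$ for all $(x,y)$. The map $(x,y)\mapsto\psi_y(x)$ is measurable from $\mathsf X\times\mathsf Y$ to $\mathsf X$. The observation-driven model is the Markov chain on $\mathsf X\times\mathsf Y$ with transition kernel $$K((x,y);dx'\,dy')=\delta_{\psi_y(x)}(dx')\,G(x';dy'),$$ and $R$ is the Markov kernel on $\mathsf X$ given by $R(x;A)=\int\mathbf 1_A(\psi_y(x))\,G(x;dy)$, $x\in\mathsf X$, $A\in\mathcal X$; $Rf(x)=\int f(x')R(x;dx')$ and $R^m$ is the $m$-th iterate. For functions $f$ real-valued and $V$ nonnegative on $\mathsf X$, $f\lesssim V$ means there is $c>0$ with $|f(x)|\le cV(x)$ for all $x\in\mathsf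 X$. *)

theory Defs
  imports "HOL-Probability.Probability"
begin

definition standard_borel_space :: "'b measure \<Rightarrow> bool" where
  "standard_borel_space M \<longleftrightarrow>
     (\<exists>T. completely_metrizable_space T \<and> separable_space T \<and> topspace T = space M \<and>
          sets M = sigma_sets (topspace T) {U. openin T U})"

text \<open>
  The space X is the type \<^typ>\<open>'a\<close> with its Borel sets. The measurable space Y is
  carried by the dominating measure \<open>\<nu>\<close>: its underlying set is \<open>space \<nu>\<close>, its sigma-field
  \<open>sets \<nu>\<close>.
\<close>

definition obs_kernel :: "'b measure \<Rightarrow> ('a \<Rightarrow> 'b \<Rightarrow> real) \<Rightarrow> 'a \<Rightarrow> 'b measure" where
  "obs_kernel \<nu> g x = density \<nu> (\<lambda>y. ennreal (g x y))"

locale dominated_observation_driven_model = sigma_finite_measure \<nu>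
  for \<nu> :: "'b measure" +
  fixes g :: "'a :: polish_space \<Rightarrow> 'b \<Rightarrow> real"
    and \<psi> :: "'b \<Rightarrow> 'a \<Rightarrow> 'a"
  assumes standard_borel: "standard_borel_space \<nu>"
    and g_measurable: "\<And>x. g x \<in> borel_measurable \<nu>"
    and g_pos: "\<And>x y. y \<in> space \<nu> \<Longrightarrow> 0 < g x y"
    and obs_kernel_measurable: "obs_kernel \<nu> g \<in> borel \<rightarrow>\<^sub>M prob_algebra \<nu>"
    and \<psi>_measurable: "(\<lambda>(x, y). \<psi> y x) \<in> borel \<Otimes>\<^sub>M \<nu> \<rightarrow>\<^sub>M borel"

text \<open>The kernel \<open>K((x,y); dx' dy') = \<delta>\<^bsub>\<psi> y x\<^esub>(dx') G(x'; dy')\<close>.\<close>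

definition joint_kernel ::
  "'b measure \<Rightarrow> ('a::topological_space \<Rightarrow> 'b \<Rightarrow> real) \<Rightarrow> ('b \<Rightarrow> 'a \<Rightarrow> 'a) \<Rightarrow> 'a \<times> 'b \<Rightarrow> ('a \<times> 'b) measure"
  where
  "joint_kernel \<nu> g \<psi> = (\<lambda>(x, y).
     return borel (\<psi> y x) \<bind> (\<lambda>x'. distr (obs_kernel \<nu> g x') (borel \<Otimes>\<^sub>M \<nu>) (Pair x')))"

text \<open>The kernel \<open>R(x; A) = \<integral> 1\<^sub>A(\<psi> y x) G(x; dy)\<close>, i.e. the image of \<open>G(x; -)\<close> under
  \<open>y \<mapsto> \<psi> y x\<close>.\<close>

definition state_kernel ::
  "'b measure \<Rightarrow> ('a::topological_space \<Rightarrow> 'b \<Rightarrow> real) \<Rightarrow> ('b \<Rightarrow> 'a \<Rightarrow> 'a) \<Rightarrow> 'a \<Rightarrow> 'a measure"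
  where
  "state_kernel \<nu> g \<psi> x = distr (obs_kernel \<nu> g x) borel (\<lambda>y. \<psi> y x)"

primrec kernel_iterate :: "('a::topological_space \<Rightarrow> 'a measure) \<Rightarrow> nat \<Rightarrow> 'a \<Rightarrow> 'a measure" where
  "kernel_iterate P 0 x = return borel x"
| "kernel_iterate P (Suc m) x = P x \<bind> kernel_iterate P m"

definition weak_feller :: "('a::topological_space \<Rightarrow> 'a measure) \<Rightarrow> bool" where
  "weak_feller P \<longleftrightarrow>
     (\<forall>f :: 'a \<Rightarrow> real. continuous_on UNIV f \<and> bounded (range f) \<longrightarrow>
        continuous_on UNIV (\<lambda>x. \<integral>x'. f x' \<partial>P x) \<and> bounded (range (\<lambda>x. \<integral>x'. f x' \<partial>P x)))"

definition reachable_point :: "('a::topological_space \<Rightarrow> 'a measure) \<Rightarrow> 'a \<Rightarrow> bool" where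
  "reachable_point P x\<^sub>0 \<longleftrightarrow>
     (\<forall>x. \<forall>N\<in>sets borel. x\<^sub>0 \<in> interior N \<longrightarrow> (\<exists>m\<ge>1. emeasure (kernel_iterate P m x) N > 0))"

definition stationary_distribution :: "'z measure \<Rightarrow> ('z \<Rightarrow> 'z measure) \<Rightarrow> 'z measure \<Rightarrow> bool" where
  "stationary_distribution M P \<pi> \<longleftrightarrow>
     prob_space \<pi> \<and> sets \<pi> = sets M \<and>
     (\<forall>A\<in>sets M. (\<integral>\<^sup>+z. emeasure (P z) A \<partial>\<pi>) = emeasure \<pi> A)"

definition lesssim :: "('a \<Rightarrow> real) \<Rightarrow> ('a \<Rightarrow> real) \<Rightarrow> bool" (infix "\<lesssim>" 50) where
  "f \<lesssim> V \<longleftrightarrow> (\<exists>c>0. \<forall>x. \<bar>f x\<bar> \<le> c * V x)"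

end

theory Submission
  imports Defs
begin

text \<open>The chain with kernel \<open>K\<close> draws the observation from \<open>G\<close> at the state just reached, so a
stationary law of \<open>K\<close> is the same thing as a stationary law \<open>\<mu>\<close> of the state kernel \<open>R\<close>
together with an observation drawn from \<open>G\<close>. Everything reduces to showing that \<open>R\<close> has
exactly one stationary law and that it integrates \<open>V\<close>.

Write \<open>T f x = \<integral> f dR(x, -)\<close>. Iterating the drift condition gives
\<open>T\<^sup>n V \<le> lam\<^sup>n V + \<beta> / (1 - lam)\<close>, so for large \<open>n\<close> only little of the mass of
\<open>R\<^sup>n(x, -)\<close> lies outside a large compact sublevel set of \<open>V\<close>. Applied to truncations of \<open>V\<close>
the same bound shows that \<open>V\<close> is integrable under every stationary law (\<open>stationary_V\<close>).

Existence (Krylov and Bogoliubov). The averages \<open>(1/(n+1)) \<Sum>k\<le>n. T\<^sup>k f x\<close>, seen as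
functionals of the bounded continuous function \<open>f\<close>, lie in a product of compact intervals and so
have a cluster point \<open>c\<close>. It is linear, positive, normalised and invariant under \<open>T\<close>.
Tightness gives it a countable subadditivity property, and a Daniell construction
(\<open>integral_representing_measure\<close>) turns it into a probability measure. Because \<open>R\<close> is weak
Feller, \<open>c (T f) = c f\<close> makes sense for all bounded continuous \<open>f\<close> and says that the measure is
stationary.

Uniqueness. By tightness a bounded continuous function \<open>h\<close> with \<open>T h = h\<close> attains its supremum.
The set where it does is closed and cannot be left by the chain, so it contains the reachable
point; the same holds for the infimum, and \<open>h\<close> is constant (\<open>harmonic_constant\<close>). If for each
bounded Lipschitz \<open>f\<close> the functions \<open>T\<^sup>n f\<close> are equicontinuous, a subsequence of the averages of
\<open>f\<close> converges pointwise to such an \<open>h\<close>, and the constant must be \<open>\<integral> f d\<mu>\<close> for every stationary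
\<open>\<mu>\<close>. Integrals of bounded Lipschitz functions determine \<open>\<mu>\<close>.

Equicontinuity. Two chains started at \<open>x\<close> and \<open>x'\<close> can receive a common observation, drawn from
\<open>G (\<phi> (x, x'))\<close>, with probability \<open>\<alpha> (x, x')\<close>; the states then move closer by the factor \<open>\<rho> < 1\<close>.
The probability of failing to do so is at most \<open>dist x x' * W (x, x')\<close>. Along the common
observations the distance decays geometrically while the mean of \<open>W\<close> grows at most linearly, so
the failure probabilities are summable, with a sum of order \<open>dist x x' * (W (x, x') + 1)\<close>. In
analytic form (\<open>iterate_modulus\<close>): a bound
\<open>\<bar>T\<^sup>n f x - T\<^sup>n f x'\<bar> \<le> dist x x' * (p + q * W (x, x'))\<close> with well chosen \<open>p\<close> and \<open>q\<close> is
reproduced by one more application of \<open>T\<close>. Local boundedness of \<open>W\<close> near the diagonal makes this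
an equicontinuity statement.\<close>

section \<open>Bounded continuous functions and cutoffs\<close>

definition bounded_continuous :: "('a::topological_space \<Rightarrow> real) \<Rightarrow> bool" where
  "bounded_continuous f \<longleftrightarrow> continuous_on UNIV f \<and> bounded (range f)"

lemma bounded_continuousI:
  assumes "continuous_on UNIV f" and "\<And>x. \<bar>f x\<bar> \<le> B"
  shows "bounded_continuous f"
  using assms unfolding bounded_continuous_def bounded_iff by auto

lemma bounded_continuousE:
  assumes "bounded_continuous f"
  obtains B where "0 \<le> B" "\<And>x. \<bar>f x\<bar> \<le> B"
proof -
  obtain B where "\<And>x. \<bar>f x\<bar> \<le> B"
    using assms unfolding bounded_continuous_def bounded_iff by auto
  moreover from this have "0 \<le> B" by (meson abs_ge_zero order_trans)
  ultimately show ?thesis using that by blast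
qed

lemma bounded_continuous_borel_measurable [measurable_dest]:
  "bounded_continuous f \<Longrightarrow> f \<in> borel_measurable borel"
  unfolding bounded_continuous_def by (auto intro: borel_measurable_continuous_onI)

lemma bounded_continuous_const: "bounded_continuous (\<lambda>x. r)"
  by (rule bounded_continuousI[of _ "\<bar>r\<bar>"]) auto

lemma bounded_continuous_add:
  assumes "bounded_continuous f" and "bounded_continuous g"
  shows "bounded_continuous (\<lambda>x. f x + g x)"
proof -
  obtain B C where "\<And>x. \<bar>f x\<bar> \<le> B" "\<And>x. \<bar>g x\<bar> \<le> C"
    using assms by (metis bounded_continuousE)
  then have "\<bar>f x + g x\<bar> \<le> B + C" for x
    by (meson abs_triangle_ineq add_mono order_trans)
  then show ?thesis
    using assms by (intro bounded_continuousI[of _ "B + C"])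
      (auto intro!: continuous_intros simp: bounded_continuous_def)
qed

lemma bounded_continuous_mult:
  assumes "bounded_continuous f" and "bounded_continuous g"
  shows "bounded_continuous (\<lambda>x. f x * g x)"
proof -
  obtain B C where "\<And>x. \<bar>f x\<bar> \<le> B" "\<And>x. \<bar>g x\<bar> \<le> C" "0 \<le> B"
    using assms by (metis bounded_continuousE)
  then have "\<bar>f x * g x\<bar> \<le> B * C" for x
    by (auto simp: abs_mult intro!: mult_mono)
  then show ?thesis
    using assms by (intro bounded_continuousI[of _ "B * C"])
      (auto intro!: continuous_intros simp: bounded_continuous_def)
qed

lemma bounded_continuous_cmult: "bounded_continuous f \<Longrightarrow> bounded_continuous (\<lambda>x. r * f x)"
  by (intro bounded_continuous_mult bounded_continuous_const)

lemma bounded_continuous_diff: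
  "bounded_continuous f \<Longrightarrow> bounded_continuous g \<Longrightarrow> bounded_continuous (\<lambda>x. f x - g x)"
  using bounded_continuous_add[OF _ bounded_continuous_cmult[of g "-1"]] by simp

lemma bounded_continuous_sum:
  "(\<And>i. i \<in> I \<Longrightarrow> bounded_continuous (f i)) \<Longrightarrow> bounded_continuous (\<lambda>x. \<Sum>i\<in>I. f i x)"
  by (induction I rule: infinite_finite_induct)
    (auto intro: bounded_continuous_add bounded_continuous_const)

lemmas bounded_continuous_intros =
  bounded_continuous_const bounded_continuous_add bounded_continuous_mult
  bounded_continuous_diff bounded_continuous_sum

text \<open>Lipschitz functions that equal \<open>1\<close> on \<open>F\<close> and decrease to its indicator as \<open>t \<rightarrow> \<infinity>\<close> when \<open>F\<close> is
closed and nonempty.\<close>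

definition cutoff :: "'a::metric_space set \<Rightarrow> real \<Rightarrow> 'a \<Rightarrow> real" where
  "cutoff F t x = max 0 (1 - t * infdist x F)"

lemma cutoff_bounds: "0 \<le> t \<Longrightarrow> 0 \<le> cutoff F t x \<and> cutoff F t x \<le> 1"
  by (auto simp: cutoff_def infdist_nonneg)

lemma cutoff_0: "cutoff F 0 x = 1"
  by (simp add: cutoff_def)

lemma cutoff_on: "x \<in> F \<Longrightarrow> cutoff F t x = 1"
  by (simp add: cutoff_def)

lemma cutoff_antimono: "s \<le> t \<Longrightarrow> cutoff F t x \<le> cutoff F s x"
  using mult_right_mono[of s t "infdist x F"] by (auto simp: cutoff_def infdist_nonneg)

lemma bounded_continuous_cutoff: "0 \<le> t \<Longrightarrow> bounded_continuous (cutoff F t)"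
  by (rule bounded_continuousI[of _ 1])
    (use cutoff_bounds in \<open>auto simp: cutoff_def infdist_nonneg intro!: continuous_intros\<close>)

lemma cutoff_lipschitz:
  assumes "0 \<le> t"
  shows "\<bar>cutoff F t x - cutoff F t y\<bar> \<le> t * dist x y"
proof -
  have "\<bar>cutoff F t x - cutoff F t y\<bar> \<le> \<bar>(1 - t * infdist x F) - (1 - t * infdist y F)\<bar>"
    unfolding cutoff_def by linarith
  also have "\<dots> = t * \<bar>infdist x F - infdist y F\<bar>"
    using assms by (simp add: abs_mult flip: right_diff_distrib abs_minus_commute)
  also have "\<dots> \<le> t * dist x y"
    using assms infdist_triangle_abs[of x F y] by (intro mult_left_mono) auto
  finally show ?thesis .
qed

lemma cutoff_eventually_0:
  assumes "closed F" "F \<noteq> {}" "x \<notin> F"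
  shows "\<forall>\<^sub>F n in sequentially. cutoff F (real n) x = 0"
proof -
  have pos: "infdist x F > 0"
    using assms by (metis in_closed_iff_infdist_zero infdist_nonneg less_eq_real_def)
  have "1 \<le> real n * infdist x F" if "n \<ge> nat \<lceil>1 / infdist x F\<rceil>" for n
    using that pos by (simp add: pos_divide_le_eq[symmetric])
  then show ?thesis
    unfolding cutoff_def eventually_sequentially by (intro exI[of _ "nat \<lceil>1 / infdist x F\<rceil>"]) auto
qed

section \<open>From a mean on bounded continuous functions to a measure\<close>

text \<open>In the last condition the sum over \<open>i\<close> is an extended nonnegative number, and the functions
\<open>F i\<close> need not add up to a bounded or continuous function. It is the one place where countable
additivity enters; for a functional that is a limit of tight measures it follows from compactness.\<close>

locale daniell_mean =
  fixes c :: "('a::metric_space \<Rightarrow> real) \<Rightarrow> real"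
  assumes add: "\<And>f g. bounded_continuous f \<Longrightarrow> bounded_continuous g \<Longrightarrow>
      c (\<lambda>x. f x + g x) = c f + c g"
    and scale: "\<And>r f. bounded_continuous f \<Longrightarrow> c (\<lambda>x. r * f x) = r * c f"
    and nonneg: "\<And>f. bounded_continuous f \<Longrightarrow> (\<And>x. 0 \<le> f x) \<Longrightarrow> 0 \<le> c f"
    and one: "c (\<lambda>x. 1) = 1"
    and cover: "\<And>F. (\<And>i. bounded_continuous (F i)) \<Longrightarrow> (\<And>i x. 0 \<le> F i x) \<Longrightarrow>
      (\<And>x. 1 \<le> (\<Sum>i::nat. ennreal (F i x))) \<Longrightarrow> 1 \<le> (\<Sum>i. ennreal (c (F i)))"
begin

lemma sum_eq:
  assumes "finite I" "\<And>i. i \<in> I \<Longrightarrow> bounded_continuous (f i)"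
  shows "c (\<lambda>x. \<Sum>i\<in>I. f i x) = (\<Sum>i\<in>I. c (f i))"
  using assms
proof (induction I rule: finite_induct)
  case empty
  then show ?case using scale[of "\<lambda>x. 1" 0] by (simp add: bounded_continuous_const)
next
  case (insert i I)
  then show ?case using add[of "f i" "\<lambda>x. \<Sum>i\<in>I. f i x"] by (simp add: bounded_continuous_sum)
qed

text \<open>The outer measure of \<open>A\<close> is the least total cost of countably many functions whose sum dominates
the indicator of \<open>A\<close>. Covering by functions instead of open sets makes countable subadditivity
immediate and lets a closed set be split off by multiplying a cover with cutoffs.\<close>

definition covers :: "'a set \<Rightarrow> (nat \<Rightarrow> 'a \<Rightarrow> real) set" where
  "covers A = {F. (\<forall>i. bounded_continuous (F i)) \<and> (\<forall>i x. 0 \<le> F i x) \<and>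
     (\<forall>x\<in>A. 1 \<le> (\<Sum>i. ennreal (F i x)))}"

definition outer :: "'a set \<Rightarrow> ennreal" where
  "outer A = (INF F\<in>covers A. \<Sum>i. ennreal (c (F i)))"

lemma covers_pairing:
  assumes bc: "\<And>k i. bounded_continuous (H k i)" and nn: "\<And>k i x. 0 \<le> H k i x"
    and cov: "\<And>x. x \<in> A \<Longrightarrow> 1 \<le> (\<Sum>k. \<Sum>i. ennreal (H k i x))"
  shows "outer A \<le> (\<Sum>k. \<Sum>i. ennreal (c (H k i)))"
proof -
  define F where "F j = case_prod H (prod_decode j)" for j
  have "(\<Sum>j. ennreal (F j x)) = (\<Sum>k. \<Sum>i. ennreal (H k i x))" for x
    using suminf_ennreal_2dimen[of "\<lambda>k. \<Sum>i. ennreal (H k i x)" "\<lambda>(k, i). ennreal (H k i x)"]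
    unfolding F_def by (simp add: case_prod_unfold)
  then have "F \<in> covers A"
    unfolding covers_def using assms by (auto simp: F_def case_prod_unfold)
  moreover have "(\<Sum>j. ennreal (c (F j))) = (\<Sum>k. \<Sum>i. ennreal (c (H k i)))"
    using suminf_ennreal_2dimen[of "\<lambda>k. \<Sum>i. ennreal (c (H k i))" "\<lambda>(k, i). ennreal (c (H k i))"]
    unfolding F_def by (simp add: case_prod_unfold)
  ultimately show ?thesis
    unfolding outer_def by (metis INF_lower)
qed

lemma outer_le_single:
  assumes "bounded_continuous f" "\<And>x. 0 \<le> f x" "\<And>x. x \<in> A \<Longrightarrow> 1 \<le> f x"
  shows "outer A \<le> ennreal (c f)"
proof -
  define F where "F i = (if i = 0 then f else (\<lambda>x. 0))" for i :: nat
  have c0: "c (\<lambda>x. 0) = 0" using sum_eq[of "{}" "\<lambda>_. f"] by simp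
  have s: "(\<Sum>i. ennreal (F i x)) = ennreal (f x)" for x
    by (subst suminf_finite[of "{0}"]) (auto simp: F_def)
  have "(\<Sum>i. ennreal (c (F i))) = ennreal (c f)"
    by (subst suminf_finite[of "{0}"]) (auto simp: F_def c0)
  moreover have "F \<in> covers A"
    unfolding covers_def mem_Collect_eq s
    using assms by (auto simp: F_def bounded_continuous_const)
  ultimately show ?thesis
    unfolding outer_def by (metis INF_lower)
qed

lemma outer_mono: "A \<subseteq> B \<Longrightarrow> outer A \<le> outer B"
  unfolding outer_def covers_def by (intro INF_superset_mono) auto

lemma outer_empty: "outer {} = 0"
  using outer_le_single[of "\<lambda>x. 0" "{}"] sum_eq[of "{}"] by (simp add: bounded_continuous_const)

lemma outer_UNIV: "outer UNIV = 1"
proof (rule antisym)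
  show "outer UNIV \<le> 1"
    using outer_le_single[of "\<lambda>x. 1" UNIV] one by (simp add: bounded_continuous_const)
  show "1 \<le> outer UNIV"
    unfolding outer_def covers_def by (intro INF_greatest) (auto intro!: cover)
qed

lemma outer_countably_subadditive: "outer (\<Union>k. A k) \<le> (\<Sum>k. outer (A k))"
proof (cases "\<forall>k. outer (A k) < \<infinity>")
  case False
  then obtain k where "outer (A k) = \<infinity>" by (metis infinity_ennreal_def less_top)
  then have "(\<Sum>k. outer (A k)) = \<infinity>"
    using ennreal_suminf_lessD[of "\<lambda>k. outer (A k)" \<infinity> k]
    by (metis infinity_ennreal_def less_irrefl less_top)
  then show ?thesis by simp
next
  case True
  show ?thesis
  proof (rule ennreal_le_epsilon)
    fix e :: real assume e: "0 < e"
    have "\<exists>F\<in>covers (A k). (\<Sum>i. ennreal (c (F i))) < outer (A k) + ennreal (e * (1/2) ^ Suc k)" for k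
      unfolding outer_def[symmetric] using True e
      by (subst INF_less_iff[symmetric]) (simp add: outer_def[symmetric] ennreal_add_left_cancel_less less_top)
    then obtain H where H: "\<And>k. H k \<in> covers (A k)"
      "\<And>k. (\<Sum>i. ennreal (c (H k i))) < outer (A k) + ennreal (e * (1/2) ^ Suc k)"
      by metis
    have "outer (\<Union>k. A k) \<le> (\<Sum>k. \<Sum>i. ennreal (c (H k i)))"
    proof (rule covers_pairing)
      fix x assume "x \<in> (\<Union>k. A k)"
      then obtain k where "x \<in> A k" by auto
      then have "1 \<le> (\<Sum>i. ennreal (H k i x))" using H(1)[of k] by (auto simp: covers_def)
      also have "\<dots> \<le> (\<Sum>k. \<Sum>i. ennreal (H k i x))"
        using sum_le_suminf[of "\<lambda>k. \<Sum>i. ennreal (H k i x)" "{k}"] by simp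
      finally show "1 \<le> (\<Sum>k. \<Sum>i. ennreal (H k i x))" .
    qed (use H(1) in \<open>auto simp: covers_def\<close>)
    also have "\<dots> \<le> (\<Sum>k. outer (A k) + ennreal (e * (1/2) ^ Suc k))"
      using H(2) by (intro suminf_le) (auto intro: less_imp_le)
    also have "\<dots> = (\<Sum>k. outer (A k)) + (\<Sum>k. ennreal (e * (1/2) ^ Suc k))"
      by (subst suminf_add[symmetric]) auto
    also have "(\<Sum>k. ennreal (e * (1/2) ^ Suc k)) = ennreal e"
    proof -
      have "(\<lambda>k. e * (1/2) ^ Suc k) sums (e * 1)"
        by (intro sums_mult power_half_series)
      then show ?thesis using e by (subst suminf_ennreal2) (auto simp: sums_iff)
    qed
    finally show "outer (\<Union>k. A k) \<le> (\<Sum>k. outer (A k)) + ennreal e" .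
  qed
qed

lemma outer_measure_space_outer: "outer_measure_space UNIV outer"
  unfolding outer_measure_space_def positive_def increasing_def countably_subadditive_def
  using outer_empty outer_mono outer_countably_subadditive by auto

text \<open>Closed sets are Caratheodory measurable. Let \<open>f\<close> be a cover of \<open>T\<close> and let \<open>u n\<close> be the cutoffs
decreasing to the indicator of \<open>F\<close>. The functions \<open>f i * u n\<close> cover the part of \<open>T\<close> inside \<open>F\<close>
for every \<open>n\<close>, and the functions \<open>f i * (u k - u (Suc k))\<close> over all \<open>k\<close> cover the part outside,
since there the differences add up to \<open>1\<close>. By telescoping, the first \<open>n\<close> differences and \<open>u n\<close>
together cost exactly as much as \<open>f\<close>.\<close>

lemma outer_closed_split:
  assumes F: "closed F" "F \<noteq> {}"
  shows "outer (T - F) + outer (T \<inter> F) \<le> outer T"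
  unfolding outer_def[of T]
proof (rule INF_greatest)
  fix f assume f: "f \<in> covers T"
  then have bc: "bounded_continuous (f i)" and nn: "0 \<le> f i x" for i x
    by (auto simp: covers_def)
  define u where "u n = cutoff F (real n)" for n :: nat
  define a where "a n x = u n x - u (Suc n) x" for n x
  have u: "0 \<le> u n x" "u n x \<le> 1" "bounded_continuous (u n)" for n x
    unfolding u_def using cutoff_bounds[of "real n" F x] bounded_continuous_cutoff[of "real n" F]
    by simp_all
  have a: "0 \<le> a n x" "bounded_continuous (a n)" for n x
  proof -
    show "0 \<le> a n x" unfolding a_def u_def by (simp add: cutoff_antimono)
    show "bounded_continuous (a n)"
      unfolding a_def using u(3)[of n] u(3)[of "Suc n"] by (rule bounded_continuous_diff)
  qed
  have tele: "(\<Sum>k<n. a k x) = 1 - u n x" for n x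
    by (induction n) (simp_all add: a_def u_def cutoff_0)
  have outside: "outer (T - F) \<le> (\<Sum>k. \<Sum>i. ennreal (c (\<lambda>x. f i x * a k x)))"
  proof (rule covers_pairing)
    fix x assume x: "x \<in> T - F"
    then have "(\<lambda>n. \<Sum>k<n. a k x) \<longlonglongrightarrow> 1"
      unfolding tele u_def using cutoff_eventually_0[OF F, of x]
      by (intro tendsto_eventually) (auto elim!: eventually_mono)
    then have "(\<lambda>k. a k x) sums 1" by (simp add: sums_def)
    then have "(\<Sum>k. ennreal (a k x)) = 1"
      using a(1) by (simp add: suminf_ennreal2 sums_iff)
    then have "1 = (\<Sum>k. ennreal (a k x)) * 1" by simp
    also have "\<dots> \<le> (\<Sum>k. ennreal (a k x)) * (\<Sum>i. ennreal (f i x))"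
      using f x by (intro mult_left_mono) (auto simp: covers_def)
    also have "\<dots> = (\<Sum>k. \<Sum>i. ennreal (f i x * a k x))"
      using nn a(1) by (simp add: ennreal_mult mult.commute)
    finally show "1 \<le> (\<Sum>k. \<Sum>i. ennreal (f i x * a k x))" .
  qed (use bc nn a in \<open>auto intro: bounded_continuous_mult\<close>)
  have "(\<Sum>k. \<Sum>i. ennreal (c (\<lambda>x. f i x * a k x))) + outer (T \<inter> F) \<le> (\<Sum>i. ennreal (c (f i)))"
  proof (rule ennreal_suminf_bound_add)
    fix n
    have split: "(\<Sum>k<n. c (\<lambda>x. f i x * a k x)) + c (\<lambda>x. f i x * u n x) = c (f i)" for i
    proof -
      have "(\<Sum>k<n. c (\<lambda>x. f i x * a k x)) + c (\<lambda>x. f i x * u n x)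
          = c (\<lambda>x. (\<Sum>k<n. f i x * a k x) + f i x * u n x)"
        using bc a u by (subst add) (auto intro!: bounded_continuous_intros simp: sum_eq bounded_continuous_mult)
      also have "(\<lambda>x. (\<Sum>k<n. f i x * a k x) + f i x * u n x) = f i"
        by (simp add: tele right_diff_distrib flip: sum_distrib_left)
      finally show ?thesis .
    qed
    have "outer (T \<inter> F) \<le> (\<Sum>i. ennreal (c (\<lambda>x. f i x * u n x)))"
      unfolding outer_def using f bc u
      by (intro INF_lower) (auto simp: covers_def u_def cutoff_on intro: bounded_continuous_mult)
    then have "(\<Sum>k<n. \<Sum>i. ennreal (c (\<lambda>x. f i x * a k x))) + outer (T \<inter> F)
        \<le> (\<Sum>i. \<Sum>k<n. ennreal (c (\<lambda>x. f i x * a k x))) + (\<Sum>i. ennreal (c (\<lambda>x. f i x * u n x)))"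
      by (subst suminf_sum) (auto intro!: add_left_mono)
    also have "\<dots> = (\<Sum>i. (\<Sum>k<n. ennreal (c (\<lambda>x. f i x * a k x))) + ennreal (c (\<lambda>x. f i x * u n x)))"
      by (intro suminf_add) auto
    also have "\<dots> = (\<Sum>i. ennreal (c (f i)))"
    proof -
      have nn': "0 \<le> c (\<lambda>x. f i x * a k x)" "0 \<le> c (\<lambda>x. f i x * u n x)" for i k
        using bc nn a u by (auto intro!: nonneg bounded_continuous_mult)
      show ?thesis
      proof (intro arg_cong[where f=suminf] ext)
        fix i
        show "(\<Sum>k<n. ennreal (c (\<lambda>x. f i x * a k x))) + ennreal (c (\<lambda>x. f i x * u n x)) = ennreal (c (f i))"
          unfolding split[of i, symmetric] using nn' by (subst sum_ennreal) (simp_all add: sum_nonneg)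
      qed
    qed
    finally show "(\<Sum>k<n. \<Sum>i. ennreal (c (\<lambda>x. f i x * a k x))) + outer (T \<inter> F)
        \<le> (\<Sum>i. ennreal (c (f i)))" .
  qed
  with outside show "outer (T - F) + outer (T \<inter> F) \<le> (\<Sum>i. ennreal (c (f i)))"
    by (meson add_right_mono order_trans)
qed

definition representing_measure :: "'a measure" where
  "representing_measure = measure_of UNIV (sets borel) outer"

lemma
  shows sets_representing_measure: "sets representing_measure = sets borel"
    and emeasure_representing_measure: "A \<in> sets borel \<Longrightarrow> emeasure representing_measure A = outer A"
    and prob_space_representing_measure: "prob_space representing_measure"
proof -
  interpret P: sigma_algebra UNIV "UNIV :: 'a set set"
    by (rule sigma_algebra_Pow[of UNIV, simplified])
  define L where "L = lambda_system UNIV (UNIV :: 'a set set) outer"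
  have ms: "measure_space UNIV L outer"
    unfolding L_def by (rule P.caratheodory_lemma[OF outer_measure_space_outer])
  then interpret L: sigma_algebra UNIV L by (simp add: measure_space_def)
  have "F \<in> L" if "closed F" for F
  proof (cases "F = {}")
    case False
    have "outer T \<le> outer (T \<inter> F) + outer (T - F)" for T
    proof -
      have sub: "subadditive UNIV outer"
        using outer_measure_space_outer P.countably_subadditive_subadditive
        unfolding outer_measure_space_def by auto
      have "T = (T \<inter> F) \<union> (T - F)" by auto
      then show ?thesis
        using subadditiveD[OF sub, of "T \<inter> F" "T - F"] by auto
    qed
    with outer_closed_split[OF that False] show ?thesis
      unfolding L_def P.lambda_system_eq by (auto simp: add.commute intro: antisym)
  qed simp
  then have "sigma_sets UNIV (Collect closed) \<subseteq> L"
    by (intro L.sigma_sets_subset) auto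
  then have sub: "sets borel \<subseteq> L"
    unfolding borel_eq_closed by simp
  have "sigma_algebra UNIV (sets (borel :: 'a measure))"
    using sets.sigma_algebra_axioms[of borel] by simp
  then have "measure_space UNIV (sets borel) outer"
    using ms sub unfolding measure_space_def positive_def countably_additive_def
    by (auto simp: subset_eq) 
  then have ms': "measure_space UNIV (sets borel) outer" .
  show s: "sets representing_measure = sets borel"
    unfolding representing_measure_def by (metis sets.sigma_sets_eq sets_measure_of space_borel subset_UNIV Pow_UNIV)
  show e: "emeasure representing_measure A = outer A" if "A \<in> sets borel" for A
    unfolding representing_measure_def using ms' that
    by (intro emeasure_measure_of_sigma) (auto simp: measure_space_def)
  show "prob_space representing_measure"
    by (rule prob_spaceI) (use e[of UNIV] outer_UNIV s sets_eq_imp_space_eq[OF s] in simp)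
qed

text \<open>Slice the graph of \<open>f\<close> into \<open>n\<close> layers of height \<open>1/n\<close>. The \<open>k\<close>-th layer, rescaled to height
\<open>1\<close>, is a continuous function that dominates the indicator of \<open>{f \<ge> (k + 1) / n}\<close>, and the layers
add up to \<open>n * f\<close>; so the upper bound \<open>outer_le_single\<close> for the measure of these sets suffices.\<close>

lemma integral_representing_measure_le:
  assumes f: "bounded_continuous f" "\<And>x. 0 \<le> f x" "\<And>x. f x \<le> 1"
  shows "(\<integral>x. f x \<partial>representing_measure) \<le> c f"
proof -
  interpret prob_space representing_measure by (rule prob_space_representing_measure)
  note [measurable_cong] = sets_representing_measure
  have [measurable]: "f \<in> borel_measurable borel" using f by measurable
  have prob_UNIV: "prob UNIV = 1"
    using prob_space sets_eq_imp_space_eq[OF sets_representing_measure] by simp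
  have le: "(\<integral>x. f x \<partial>representing_measure) \<le> 1 / real n + c f" if n: "0 < n" for n :: nat
  proof -
    define level where "level k x = max 0 (min 1 (real n * f x - real k))" for k x
    have bc: "bounded_continuous (level k)" for k
      unfolding level_def using f(1)
      by (intro bounded_continuousI[of _ 1]) (auto intro!: continuous_intros simp: bounded_continuous_def)
    have level_sum: "(\<Sum>k<m. level k x) = min (real m) (real n * f x)" for m x
    proof (induction m)
      case (Suc m)
      then show ?case unfolding level_def by (simp add: min_def max_def)
    qed (use f(2) in simp)
    have level_sum: "(\<Sum>k<n. level k x) = real n * f x" for x
      using level_sum[of x n] f(3)[of x] n by (simp add: mult_left_le)
    define A where "A k = {x. real k + 1 \<le> real n * f x}" for k :: nat
    have A [measurable]: "A k \<in> sets borel" for k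
      unfolding A_def by measurable
    have meas_le: "measure representing_measure (A k) \<le> c (level k)" for k
    proof -
      have "emeasure representing_measure (A k) \<le> ennreal (c (level k))"
        unfolding emeasure_representing_measure[OF A]
        by (rule outer_le_single[OF bc]) (auto simp: level_def A_def)
      then show ?thesis
        unfolding emeasure_eq_measure
        by (subst (asm) ennreal_le_iff) (auto intro!: nonneg bc simp: level_def)
    qed
    have step: "f x \<le> 1 / n + (\<Sum>k<n. indicator (A k) x) / n" for x
    proof -
      \<comment> \<open>The graph ends inside at most one layer, the one of index \<open>\<lfloor>n * f x\<rfloor>\<close>.\<close>
      have "level k x \<le> indicator (A k) x + (if k = nat \<lfloor>real n * f x\<rfloor> then 1 else 0)" for k
      proof (cases "real k + 1 \<le> real n * f x")
        case False
        moreover have "0 \<le> real n * f x" using f(2) by simp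
        ultimately show ?thesis
          unfolding level_def A_def by (auto simp: indicator_def max_def min_def) linarith+
      qed (auto simp: level_def A_def)
      then have "(\<Sum>k<n. level k x) \<le>
          (\<Sum>k<n. indicator (A k) x + (if k = nat \<lfloor>real n * f x\<rfloor> then 1 else 0))"
        by (intro sum_mono) 
      also have "\<dots> \<le> (\<Sum>k<n. indicator (A k) x) + 1"
        by (simp add: sum.distrib)
      finally show ?thesis
        unfolding level_sum using n by (simp add: field_simps)
    qed
    have "(\<integral>x. f x \<partial>representing_measure) \<le> (\<integral>x. 1 / n + (\<Sum>k<n. indicator (A k) x) / n \<partial>representing_measure)"
      using f by (intro integral_mono step integrable_const_bound[of _ 1] Bochner_Integration.integrable_add
          Bochner_Integration.integrable_divide Bochner_Integration.integrable_sum) 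
        (auto simp: emeasure_eq_measure)
    also have "\<dots> = 1 / n + (\<Sum>k<n. measure representing_measure (A k)) / n"
      by (subst Bochner_Integration.integral_add)
       (auto intro!: Bochner_Integration.integrable_sum Bochner_Integration.integrable_divide
          simp: emeasure_eq_measure prob_UNIV sets_eq_imp_space_eq[OF sets_representing_measure])
    also have "\<dots> \<le> 1 / n + (\<Sum>k<n. c (level k)) / n"
      by (intro add_left_mono divide_right_mono sum_mono meas_le) auto
    also have "(\<Sum>k<n. c (level k)) = c (\<lambda>x. real n * f x)"
      using sum_eq[of "{..<n}" level] bc by (simp add: level_sum)
    also have "\<dots> / n = c f" using n f scale by simp
    finally show ?thesis .
  qed
  have "(\<lambda>n. 1 / real n + c f) \<longlonglongrightarrow> c f"
    by (auto intro!: tendsto_eq_intros lim_1_over_n)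
  then show ?thesis
    by (rule LIMSEQ_le_const) (use le in \<open>auto intro!: exI[of _ 1]\<close>)
qed

text \<open>One inequality is enough: it applies to \<open>f\<close> and to \<open>- f\<close> after an affine rescaling into \<open>[0, 1]\<close>,
because both sides agree on constants.\<close>

lemma integral_representing_measure:
  assumes f: "bounded_continuous f"
  shows "(\<integral>x. f x \<partial>representing_measure) = c f"
proof -
  interpret prob_space representing_measure by (rule prob_space_representing_measure)
  note [measurable_cong] = sets_representing_measure
  have [measurable]: "f \<in> borel_measurable borel" using f by measurable
  obtain B where B: "\<And>x. \<bar>f x\<bar> \<le> B" "0 \<le> B" using f by (metis bounded_continuousE)
  define D where "D = B + 1"
  have D: "0 < D" "\<And>x. \<bar>f x\<bar> \<le> D" using B by (auto simp: D_def intro: add_increasing2)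
  have int: "integrable representing_measure f"
    by (rule integrable_const_bound[of _ B]) (use B in auto)
  have le: "(\<integral>x. r * f x + 1/2 \<partial>representing_measure) \<le> c (\<lambda>x. r * f x + 1/2)" if r: "\<bar>r\<bar> = 1 / (2 * D)" for r
  proof (rule integral_representing_measure_le)
    show "bounded_continuous (\<lambda>x. r * f x + 1/2)" using f by (intro bounded_continuous_intros)
    have half: "\<bar>r * f x\<bar> \<le> 1/2" for x
      using D(2)[of x] D(1) by (simp add: abs_mult r field_simps)
    then show "0 \<le> r * f x + 1/2" "r * f x + 1/2 \<le> 1" for x
      using half[of x] by linarith+
  qed
  have expand: "(\<integral>x. r * f x + 1/2 \<partial>representing_measure) = r * (\<integral>x. f x \<partial>representing_measure) + 1/2" for r
    using int by (simp add: prob_space)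
  have expand': "c (\<lambda>x. r * f x + 1/2) = r * c f + 1/2" for r
    using f scale[of f r] scale[of "\<lambda>x. 1" "1/2"] one
    by (subst add) (auto intro: bounded_continuous_intros)
  have "1 / (2 * D) * (\<integral>x. f x \<partial>representing_measure) \<le> 1 / (2 * D) * c f"
    using le[of "1 / (2 * D)"] D(1) unfolding expand expand' by simp
  moreover have "- (1 / (2 * D)) * (\<integral>x. f x \<partial>representing_measure) \<le> - (1 / (2 * D)) * c f"
    using le[of "- (1 / (2 * D))"] D(1) unfolding expand expand' by simp
  ultimately show ?thesis
    using D(1) by (simp add: divide_right_mono field_simps)
qed

end

section \<open>Bounded Lipschitz functions determine a probability measure\<close>

lemma prob_measure_eqI_lipschitz:
  fixes M N :: "'a::metric_space measure"
  assumes "prob_space M" "prob_space N"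
    and sets: "sets M = sets borel" "sets N = sets borel"
    and eq: "\<And>f L. bounded_continuous f \<Longrightarrow> (\<And>x y. \<bar>f x - f y\<bar> \<le> L * dist x y) \<Longrightarrow>
      (\<integral>x. f x \<partial>M) = (\<integral>x. f x \<partial>N)"
  shows "M = N"
proof -
  have lim: "(\<lambda>n. \<integral>x. cutoff F (real n) x \<partial>P) \<longlonglongrightarrow> measure P F"
    if P: "prob_space P" "sets P = sets borel" and F: "closed F" "F \<noteq> {}"
    for P :: "'a measure" and F
  proof -
    interpret prob_space P by (rule P(1))
    note [measurable_cong] = P(2)
    have [measurable]: "cutoff F (real n) \<in> borel_measurable borel" for n
      using bounded_continuous_cutoff[of "real n" F] by measurable
    have [measurable]: "F \<in> sets borel" using F(1) by simp
    have "(\<lambda>n. \<integral>x. cutoff F (real n) x \<partial>P) \<longlonglongrightarrow> (\<integral>x. indicator F x \<partial>P)"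
    proof (rule integral_dominated_convergence[where w="\<lambda>_. 1"])
      show "AE x in P. (\<lambda>n. cutoff F (real n) x) \<longlonglongrightarrow> indicator F x"
      proof (intro AE_I2)
        fix x
        show "(\<lambda>n. cutoff F (real n) x) \<longlonglongrightarrow> indicator F x"
          using cutoff_eventually_0[OF F, of x]
          by (cases "x \<in> F") (auto simp: cutoff_on intro: tendsto_eventually)
      qed
      show "AE x in P. norm (cutoff F (real n) x) \<le> 1" for n
        using cutoff_bounds[of "real n" F] by (intro AE_I2) auto
    qed auto
    then show ?thesis by (simp add: P(2))
  qed
  have closed_eq: "emeasure M F = emeasure N F" if F: "closed F" for F
  proof (cases "F = {}")
    case False
    have "(\<integral>x. cutoff F (real n) x \<partial>M) = (\<integral>x. cutoff F (real n) x \<partial>N)" for n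
      by (intro eq[of _ "real n"] bounded_continuous_cutoff cutoff_lipschitz) auto
    then have "measure M F = measure N F"
      using lim[OF assms(1) sets(1) F False] lim[OF assms(2) sets(2) F False]
      by (auto intro: LIMSEQ_unique)
    then show ?thesis
      using assms(1,2) by (simp add: finite_measure.emeasure_eq_measure prob_space_def)
  qed simp
  show ?thesis
  proof (rule measure_eqI_generator_eq[of "Collect closed" UNIV M N "\<lambda>_. UNIV"])
    show "sets M = sigma_sets UNIV (Collect closed)" "sets N = sigma_sets UNIV (Collect closed)"
      unfolding sets borel_eq_closed by auto
    show "emeasure M UNIV \<noteq> \<infinity>"
      using assms(1) by (simp add: finite_measure.emeasure_eq_measure prob_space_def)
  qed (auto simp: Int_stable_def closed_eq)
qed

section \<open>Markov kernels acting on functions\<close>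

locale markov_kernel =
  fixes R :: "'a::polish_space \<Rightarrow> 'a measure"
  assumes kernel: "R \<in> borel \<rightarrow>\<^sub>M prob_algebra borel"
begin

lemma kernel_subprob [measurable]: "R \<in> borel \<rightarrow>\<^sub>M subprob_algebra borel"
  by (rule measurable_prob_algebraD[OF kernel])

lemma sets_kernel_eq [simp, measurable_cong]: "sets (R x) = sets borel"
  using measurable_space[OF kernel, of x] by (simp add: space_prob_algebra)

lemma space_kernel_eq [simp]: "space (R x) = UNIV"
  using sets_eq_imp_space_eq[OF sets_kernel_eq] by simp

lemma prob_space_kernel: "prob_space (R x)"
  using measurable_space[OF kernel, of x] by (simp add: space_prob_algebra)

definition T :: "('a \<Rightarrow> real) \<Rightarrow> 'a \<Rightarrow> real" where
  "T f x = (\<integral>x'. f x' \<partial>R x)"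

lemma integrable_kernel:
  fixes f :: "'a \<Rightarrow> real"
  assumes "f \<in> borel_measurable borel" "\<And>x. \<bar>f x\<bar> \<le> B"
  shows "integrable (R x) f"
proof -
  interpret prob_space "R x" by (rule prob_space_kernel)
  show ?thesis using assms by (intro integrable_const_bound[of _ B]) auto
qed

lemma T_measurable:
  assumes [measurable]: "f \<in> borel_measurable borel"
  shows "T f \<in> borel_measurable borel"
  unfolding T_def[abs_def]
  by (rule measurable_compose[OF kernel_subprob integral_measurable_subprob_algebra]) simp

lemma T_bound:
  assumes "f \<in> borel_measurable borel" "\<And>x. \<bar>f x\<bar> \<le> B"
  shows "\<bar>T f x\<bar> \<le> B"
proof -
  interpret prob_space "R x" by (rule prob_space_kernel)
  have int: "integrable (R x) f" using assms by (rule integrable_kernel)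
  have lo: "- B \<le> f y" and hi: "f y \<le> B" for y
    using assms(2)[of y] by (auto simp: abs_le_iff)
  have "T f x \<le> B" "-B \<le> T f x"
    unfolding T_def using integral_le_const[OF int, of B] integral_ge_const[OF int, of "-B"] lo hi
    by auto
  then show ?thesis by auto
qed

lemma iterate_measurable:
  "f \<in> borel_measurable borel \<Longrightarrow> (T ^^ n) f \<in> borel_measurable borel"
  by (induction n) (auto intro: T_measurable)

lemma iterate_bound:
  assumes "f \<in> borel_measurable borel" "\<And>x. \<bar>f x\<bar> \<le> B"
  shows "\<bar>(T ^^ n) f x\<bar> \<le> B"
  by (induction n arbitrary: x) (use assms in \<open>auto intro!: T_bound iterate_measurable\<close>)

lemma iterate_add:
  assumes "bounded_continuous f" "bounded_continuous g"
  shows "(T ^^ n) (\<lambda>x. f x + g x) = (\<lambda>x. (T ^^ n) f x + (T ^^ n) g x)"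
proof (induction n)
  case (Suc n)
  obtain B C where "\<And>x. \<bar>f x\<bar> \<le> B" "\<And>x. \<bar>g x\<bar> \<le> C"
    using assms by (metis bounded_continuousE)
  then have "integrable (R x) ((T ^^ n) f)" "integrable (R x) ((T ^^ n) g)" for x
    using assms by (auto intro!: integrable_kernel iterate_bound iterate_measurable
      intro: bounded_continuous_borel_measurable)
  then have "T (\<lambda>x. (T ^^ n) f x + (T ^^ n) g x) = (\<lambda>x. T ((T ^^ n) f) x + T ((T ^^ n) g) x)"
    by (intro ext, subst (1 2 3) T_def) (rule Bochner_Integration.integral_add)
  then show ?case using Suc by simp
qed simp

lemma iterate_cmult: "(T ^^ n) (\<lambda>x. r * f x) = (\<lambda>x. r * (T ^^ n) f x)"
  by (induction n) (simp_all add: T_def[abs_def])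

lemma iterate_const: "(T ^^ n) (\<lambda>x. r) = (\<lambda>x. r)"
proof -
  have "measure (R x) UNIV = 1" for x
    using prob_space.prob_space[OF prob_space_kernel, of x] by simp
  then show ?thesis by (induction n) (simp_all add: T_def[abs_def])
qed

lemma stationary_bind:
  assumes "stationary_distribution borel R \<mu>"
  shows "\<mu> \<bind> R = \<mu>"
proof (rule measure_eqI)
  have s: "sets \<mu> = sets borel" and p: "prob_space \<mu>"
    using assms by (auto simp: stationary_distribution_def)
  note [measurable_cong] = s
  have ne: "space \<mu> \<noteq> {}" using p by (rule prob_space.not_empty)
  show sb: "sets (\<mu> \<bind> R) = sets \<mu>" using ne by (subst sets_bind[of _ _ borel]) (auto simp: s)
  fix A assume "A \<in> sets (\<mu> \<bind> R)"
  then have A: "A \<in> sets borel" by (simp only: sb s)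
  then show "emeasure (\<mu> \<bind> R) A = emeasure \<mu> A"
    using assms ne by (subst emeasure_bind[of _ _ borel]) (auto simp: stationary_distribution_def)
qed

lemma stationary_integral_T:
  assumes "stationary_distribution borel R \<mu>"
    and f: "f \<in> borel_measurable borel" "\<And>x. \<bar>f x\<bar> \<le> B"
  shows "(\<integral>x. T f x \<partial>\<mu>) = (\<integral>x. f x \<partial>\<mu>)"
proof -
  have s [measurable_cong]: "sets \<mu> = sets borel" and p: "prob_space \<mu>"
    using assms by (auto simp: stationary_distribution_def)
  have "(\<integral>x. f x \<partial>(\<mu> \<bind> R)) = (\<integral>x. T f x \<partial>\<mu>)"
    unfolding T_def
    using f p by (intro integral_bind[where B=B and B'=1 and K=borel])
      (auto simp: prob_space_def prob_space.emeasure_space_1[OF prob_space_kernel, simplified])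
  then show ?thesis unfolding stationary_bind[OF assms(1)] by simp
qed

lemma stationary_integral_iterate:
  assumes "stationary_distribution borel R \<mu>"
    and f: "f \<in> borel_measurable borel" "\<And>x. \<bar>f x\<bar> \<le> B"
  shows "(\<integral>x. (T ^^ n) f x \<partial>\<mu>) = (\<integral>x. f x \<partial>\<mu>)"
proof (induction n)
  case (Suc n)
  then show ?case
    using stationary_integral_T[OF assms(1) iterate_measurable[OF f(1)] iterate_bound[OF f]] by simp
qed simp

lemma stationaryI:
  assumes p: "prob_space \<mu>" and s: "sets \<mu> = sets borel"
    and eq: "\<And>f. bounded_continuous f \<Longrightarrow> (\<integral>x. T f x \<partial>\<mu>) = (\<integral>x. f x \<partial>\<mu>)"
  shows "stationary_distribution borel R \<mu>"
proof -
  interpret prob_space \<mu> by (rule p)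
  note [measurable_cong] = s
  have sb: "sets (\<mu> \<bind> R) = sets borel" by (rule sets_bind) (auto simp: not_empty)
  have "\<mu> \<bind> R = \<mu>"
  proof (rule prob_measure_eqI_lipschitz)
    show "prob_space (\<mu> \<bind> R)"
      by (rule prob_space_bind[of _ borel]) (auto simp: prob_space_kernel)
    fix f :: "'a \<Rightarrow> real" assume f: "bounded_continuous f"
    then obtain B where "\<And>x. \<bar>f x\<bar> \<le> B" by (metis bounded_continuousE)
    then have "(\<integral>x. f x \<partial>(\<mu> \<bind> R)) = (\<integral>x. T f x \<partial>\<mu>)"
      unfolding T_def
      using f p by (intro integral_bind[where B=B and B'=1 and K=borel])
        (auto simp: prob_space_def prob_space.emeasure_space_1[OF prob_space_kernel, simplified])
    with eq[OF f] show "(\<integral>x. f x \<partial>(\<mu> \<bind> R)) = (\<integral>x. f x \<partial>\<mu>)" by simp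
  qed (use p s sb in auto)
  then show ?thesis
    unfolding stationary_distribution_def
    using p s emeasure_bind[of \<mu> R borel] not_empty by (auto simp: measurable_cong_sets[OF s refl])
qed

lemma kernel_iterate_measurable: "kernel_iterate R m \<in> borel \<rightarrow>\<^sub>M prob_algebra borel"
proof (induction m)
  case 0
  then show ?case by (simp add: measurable_return_prob_space cong: measurable_cong)
next
  case (Suc m)
  have "kernel_iterate R (Suc m) = (\<lambda>x. R x \<bind> kernel_iterate R m)" by (rule ext) simp
  then show ?case using measurable_bind_prob_space[OF kernel Suc] by simp
qed

text \<open>Otherwise the complement of \<open>E\<close> would be a neighbourhood of \<open>x0\<close> that a chain started in \<open>E\<close>
never enters.\<close>

lemma reachable_in_absorbing:
  assumes x0: "reachable_point R x0" and E: "closed E" "E \<noteq> {}"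
    and absorbing: "\<And>x. x \<in> E \<Longrightarrow> AE x' in R x. x' \<in> E"
  shows "x0 \<in> E"
proof (rule ccontr)
  assume "x0 \<notin> E"
  have [measurable]: "E \<in> sets borel" using E by simp
  obtain x where "x \<in> E" using E by auto
  have "emeasure (kernel_iterate R m x) (-E) = 0" if "x \<in> E" for m x
    using that
  proof (induction m arbitrary: x)
    case (Suc m)
    have "emeasure (kernel_iterate R (Suc m) x) (-E) = (\<integral>\<^sup>+z. emeasure (kernel_iterate R m z) (-E) \<partial>R x)"
      by (simp, rule emeasure_bind[of _ _ borel])
        (auto intro!: measurable_prob_algebraD kernel_iterate_measurable
          simp: measurable_cong_sets[OF sets_kernel_eq refl])
    also have "\<dots> = (\<integral>\<^sup>+z. 0 \<partial>R x)"
      using absorbing[OF Suc.prems] by (intro nn_integral_cong_AE) (auto elim!: eventually_mono intro: Suc.IH)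
    finally show ?case by simp
  qed (auto simp: indicator_def)
  moreover have "x0 \<in> interior (-E)" using E \<open>x0 \<notin> E\<close> by (simp add: interior_open open_Compl)
  ultimately show False
    using x0 \<open>x \<in> E\<close> unfolding reachable_point_def by (metis \<open>E \<in> sets borel\<close> borel_comp less_irrefl)
qed

text \<open>The Cesaro averages start at \<open>k = 0\<close> and have \<open>n + 1\<close> terms, so that no division by zero occurs.\<close>

definition average :: "nat \<Rightarrow> ('a \<Rightarrow> real) \<Rightarrow> 'a \<Rightarrow> real" where
  "average n f x = (\<Sum>k\<le>n. (T ^^ k) f x) / real (Suc n)"

lemma average_bound:
  assumes "f \<in> borel_measurable borel" "\<And>x. \<bar>f x\<bar> \<le> B"
  shows "\<bar>average n f x\<bar> \<le> B"
proof -
  have "\<bar>\<Sum>k\<le>n. (T ^^ k) f x\<bar> \<le> (\<Sum>k\<le>n. B)"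
    by (rule order_trans[OF sum_abs sum_mono]) (rule iterate_bound[OF assms])
  then show ?thesis
    unfolding average_def by (simp add: abs_divide pos_divide_le_eq mult.commute)
qed

lemma average_measurable:
  "f \<in> borel_measurable borel \<Longrightarrow> average n f \<in> borel_measurable borel"
  unfolding average_def[abs_def]
  by (intro borel_measurable_divide borel_measurable_sum iterate_measurable) auto

text \<open>Applying \<open>T\<close> shifts the terms of the average by one, so that all but the two extreme ones cancel.
This is why limits of averages are invariant under \<open>T\<close>.\<close>

lemma average_T:
  "average n (T f) x - average n f x = ((T ^^ Suc n) f x - f x) / real (Suc n)"
proof -
  have "(\<Sum>k\<le>n. (T ^^ k) (T f) x) - (\<Sum>k\<le>n. (T ^^ k) f x) = (T ^^ Suc n) f x - f x" for n
    by (induction n) (simp_all add: funpow_swap1)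
  then show ?thesis unfolding average_def by (simp add: diff_divide_distrib[symmetric])
qed

lemma average_T_tendsto:
  assumes "f \<in> borel_measurable borel" "\<And>x. \<bar>f x\<bar> \<le> B"
  shows "(\<lambda>n. average n (T f) x - average n f x) \<longlonglongrightarrow> 0"
proof (rule Lim_null_comparison)
  have "\<bar>(T ^^ Suc n) f x - f x\<bar> \<le> 2 * B" for n
    using iterate_bound[OF assms, of "Suc n" x] assms(2)[of x] by linarith
  then show "\<forall>\<^sub>F n in sequentially. norm (average n (T f) x - average n f x) \<le> 2 * B * (1 / real (Suc n))"
    unfolding average_T by (auto simp: abs_divide divide_right_mono)
  show "(\<lambda>n. 2 * B * (1 / real (Suc n))) \<longlonglongrightarrow> 0"
    using tendsto_mult[OF tendsto_const LIMSEQ_Suc[OF lim_1_over_n], of "2 * B"] by simp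
qed

lemma stationary_integral_average:
  assumes st: "stationary_distribution borel R \<mu>"
    and f: "f \<in> borel_measurable borel" "\<And>x. \<bar>f x\<bar> \<le> B"
  shows "(\<integral>x. average n f x \<partial>\<mu>) = (\<integral>x. f x \<partial>\<mu>)"
proof -
  have [measurable_cong]: "sets \<mu> = sets borel" and "prob_space \<mu>"
    using st by (auto simp: stationary_distribution_def)
  then interpret prob_space \<mu> by simp
  have "integrable \<mu> ((T ^^ k) f)" for k
    using iterate_measurable[OF f(1), of k] iterate_bound[OF f, of k]
    by (intro integrable_const_bound[of _ B]) auto
  then show ?thesis
    unfolding average_def using stationary_integral_iterate[OF st f] by simp
qed

lemma T_average:
  assumes "f \<in> borel_measurable borel" "\<And>x. \<bar>f x\<bar> \<le> B"
  shows "T (average n f) x = average n (T f) x"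
proof -
  have "integrable (R x) ((T ^^ k) f)" for k
    using iterate_measurable[OF assms(1)] iterate_bound[OF assms] by (rule integrable_kernel)
  then have "(\<integral>x'. average n f x' \<partial>R x) = (\<Sum>k\<le>n. (\<integral>x'. (T ^^ k) f x' \<partial>R x)) / real (Suc n)"
    unfolding average_def by simp
  then show ?thesis
    unfolding T_def[symmetric] by (simp add: average_def funpow_swap1)
qed

lemma average_add:
  assumes "bounded_continuous f" "bounded_continuous g"
  shows "average n (\<lambda>x. f x + g x) x = average n f x + average n g x"
  unfolding average_def iterate_add[OF assms] by (simp add: sum.distrib add_divide_distrib)

lemma average_cmult: "average n (\<lambda>x. r * f x) x = r * average n f x"
  unfolding average_def iterate_cmult by (simp flip: sum_distrib_left)

lemma average_const: "average n (\<lambda>x. r) x = r"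
  unfolding average_def iterate_const by simp

lemma average_nonneg:
  assumes "\<And>x. 0 \<le> f x"
  shows "0 \<le> average n f x"
proof -
  have "0 \<le> (T ^^ k) f y" for k y
    by (induction k arbitrary: y) (use assms in \<open>auto simp: T_def\<close>)
  then show ?thesis unfolding average_def by (intro divide_nonneg_nonneg sum_nonneg) auto
qed

end

section \<open>Convergent subsequences of equicontinuous functions\<close>

text \<open>The values on a countable dense set live in a compact metrizable product of intervals, which
yields a subsequence converging there. Equicontinuity at a point \<open>x\<close> transfers the Cauchy property
from a nearby point of the dense set to \<open>x\<close>, and makes the limit continuous.\<close>

lemma equicontinuous_convergent_subsequence:
  fixes u :: "nat \<Rightarrow> 'a::{metric_space, second_countable_topology} \<Rightarrow> real"
  assumes bound: "\<And>n x. \<bar>u n x\<bar> \<le> B"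
    and equi: "\<And>x e. 0 < e \<Longrightarrow> \<exists>d>0. \<forall>n y. dist x y < d \<longrightarrow> \<bar>u n x - u n y\<bar> < e"
  obtains r h where "strict_mono (r :: nat \<Rightarrow> nat)" "\<And>x. (\<lambda>n. u (r n) x) \<longlonglongrightarrow> h x"
    "continuous_on UNIV h"
proof -
  obtain D :: "'a set" where D: "countable D" "\<And>X. open X \<Longrightarrow> X \<noteq> {} \<Longrightarrow> \<exists>d\<in>D. d \<in> X"
    using countable_dense_setE by blast
  have "D \<noteq> {}" using D(2)[of UNIV] by auto
  define p where "p = from_nat_into D"
  have p: "\<exists>i. p i \<in> X" if "open X" "X \<noteq> {}" for X
    using D that from_nat_into_surj[OF D(1)] unfolding p_def by metis
  have "compact (PiE UNIV (\<lambda>_::nat. {-B..B}))"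
    using compactin_PiE[of "\<lambda>_. euclidean" UNIV "\<lambda>_::nat. {-B..B}"]
    by (simp add: euclidean_product_topology)
  then have "seq_compact (PiE UNIV (\<lambda>_::nat. {-B..B}))"
    by (rule compact_imp_seq_compact)
  moreover have "\<forall>n. (\<lambda>i. u n (p i)) \<in> PiE UNIV (\<lambda>_::nat. {-B..B})"
    using bound by (auto simp: abs_le_iff minus_le_iff)
  ultimately obtain l r where r: "strict_mono (r :: nat \<Rightarrow> nat)"
    and l: "((\<lambda>n i. u n (p i)) \<circ> r) \<longlonglongrightarrow> l"
    by (rule seq_compactE)
  have conv_p: "(\<lambda>n. u (r n) (p i)) \<longlonglongrightarrow> l i" for i
  proof -
    have "isCont (\<lambda>z :: nat \<Rightarrow> real. z i) l"
      using continuous_on_product_coordinates[of i]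
      by (metis UNIV_I continuous_on_eq_continuous_at open_UNIV)
    from isCont_tendsto_compose[OF this l] show ?thesis by (simp add: o_def)
  qed
  have "Cauchy (\<lambda>n. u (r n) x)" for x
  proof (rule metric_CauchyI)
    fix e :: real assume "0 < e"
    then obtain d where d: "0 < d" "\<And>n y. dist x y < d \<Longrightarrow> \<bar>u n x - u n y\<bar> < e / 3"
      using equi[of "e / 3" x] by auto
    obtain i where i: "dist x (p i) < d"
      using p[of "ball x d"] d(1) by auto
    have "Cauchy (\<lambda>n. u (r n) (p i))" using conv_p by (rule LIMSEQ_imp_Cauchy)
    then obtain N where N: "\<And>m n. N \<le> m \<Longrightarrow> N \<le> n \<Longrightarrow> dist (u (r m) (p i)) (u (r n) (p i)) < e / 3"
      using \<open>0 < e\<close> by (metis metric_CauchyD divide_pos_pos zero_less_numeral)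
    show "\<exists>N. \<forall>m\<ge>N. \<forall>n\<ge>N. dist (u (r m) x) (u (r n) x) < e"
    proof (intro exI[of _ N] allI impI)
      fix m n assume "N \<le> m" "N \<le> n"
      then show "dist (u (r m) x) (u (r n) x) < e"
        using N[of m n] d(2)[OF i, of "r m"] d(2)[OF i, of "r n"] unfolding dist_real_def by linarith
    qed
  qed
  then have "\<exists>h. \<forall>x. (\<lambda>n. u (r n) x) \<longlonglongrightarrow> h x"
    by (intro choice) (simp add: Cauchy_convergent_iff convergent_def)
  then obtain h where h: "\<And>x. (\<lambda>n. u (r n) x) \<longlonglongrightarrow> h x" by auto
  have "continuous_on UNIV h"
    unfolding continuous_on_iff
  proof (intro ballI allI impI)
    fix x and e :: real assume "0 < e"
    then obtain d where d: "0 < d" "\<And>n y. dist x y < d \<Longrightarrow> \<bar>u n x - u n y\<bar> < e / 2"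
      using equi[of "e / 2" x] by auto
    show "\<exists>d>0. \<forall>y\<in>UNIV. dist y x < d \<longrightarrow> dist (h y) (h x) < e"
    proof (intro exI[of _ d] conjI ballI impI)
      fix y assume "dist y x < d"
      then have "\<bar>u (r n) x - u (r n) y\<bar> \<le> e / 2" for n
        using d(2)[of y "r n"] by (simp add: dist_commute)
      then have "\<bar>h x - h y\<bar> \<le> e / 2"
        by (intro LIMSEQ_le_const2[OF tendsto_rabs[OF tendsto_diff[OF h h]]]) auto
      then show "dist (h y) (h x) < e"
        using \<open>0 < e\<close> by (simp add: dist_real_def abs_minus_commute)
    qed (use d in auto)
  qed
  with that r h show ?thesis by blast
qed

section \<open>Drift conditions\<close>

locale drift_kernel = markov_kernel R for R :: "'a::polish_space \<Rightarrow> 'a measure" +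
  fixes V :: "'a \<Rightarrow> real" and lam \<beta> :: real
  assumes lam: "0 < lam" "lam < 1" and \<beta>: "0 \<le> \<beta>"
    and V_measurable [measurable]: "V \<in> borel_measurable borel" and V_nonneg: "\<And>x. 0 \<le> V x"
    and drift: "\<And>x. (\<integral>\<^sup>+x'. ennreal (V x') \<partial>R x) \<le> ennreal (lam * V x + \<beta>)"
begin

text \<open>The fixed point of \<open>v \<mapsto> lam * v + \<beta>\<close>, hence the long-run bound on the mean of \<open>V\<close>. Measured
from this level the drift condition is purely multiplicative: \<open>T (V - level) \<le> lam * (V - level)\<close>.\<close>

definition level where "level = \<beta> / (1 - lam)"

lemma level_nonneg: "0 \<le> level"
  unfolding level_def using lam \<beta> by simp

lemma integrable_V: "integrable (R x) V"
  and integral_V_le: "(\<integral>x'. V x' \<partial>R x) \<le> lam * V x + \<beta>"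
proof -
  have nn: "0 \<le> lam * V x + \<beta>" using lam \<beta> V_nonneg by simp
  show int: "integrable (R x) V"
    using drift[of x] V_nonneg by (intro integrableI_nonneg) (auto simp: le_less_trans)
  show "(\<integral>x'. V x' \<partial>R x) \<le> lam * V x + \<beta>"
    using drift[of x] nn_integral_eq_integral[OF int] V_nonneg nn by simp
qed

lemma iterate_drift:
  assumes f: "f \<in> borel_measurable borel" "\<And>x. \<bar>f x\<bar> \<le> B"
    and k: "0 \<le> k" and le: "\<And>x. f x \<le> a + k * (V x - level)"
  shows "(T ^^ n) f x \<le> a + k * lam ^ n * (V x - level)"
proof (induction n arbitrary: x)
  case (Suc n)
  interpret prob_space "R x" by (rule prob_space_kernel)
  have pu: "prob UNIV = 1" using prob_space by simp
  have k': "0 \<le> k * lam ^ n" using k lam by simp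
  have "(T ^^ Suc n) f x = (\<integral>x'. (T ^^ n) f x' \<partial>R x)" by (simp add: T_def)
  also have "\<dots> \<le> (\<integral>x'. a + k * lam ^ n * (V x' - level) \<partial>R x)"
    using integrable_V
    by (intro integral_mono Suc integrable_kernel[OF iterate_measurable[OF f(1)] iterate_bound[OF f]]) auto
  also have "\<dots> = a + k * lam ^ n * ((\<integral>x'. V x' \<partial>R x) - level)"
    using integrable_V by (simp add: pu)
  also have "\<dots> \<le> a + k * lam ^ n * (lam * V x + \<beta> - level)"
    using integral_V_le k' by (intro add_left_mono mult_left_mono) auto
  also have "lam * V x + \<beta> - level = lam * (V x - level)"
    unfolding level_def using lam by (simp add: field_simps)
  finally show ?case by (simp add: mult_ac)
qed (use le in simp)

text \<open>\<open>V\<close> is not known to be integrable, so the drift is applied to the truncations \<open>min N V\<close>: under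
\<open>\<mu>\<close> their integral is that of \<open>T\<^sup>n (min N V) \<le> min N (level + lam\<^sup>n V)\<close>, whose limit in \<open>n\<close> is
at most \<open>level\<close> by dominated convergence. Then \<open>N\<close> tends to infinity.\<close>

lemma stationary_V:
  assumes st: "stationary_distribution borel R \<mu>"
  shows "(\<integral>\<^sup>+x. ennreal (V x) \<partial>\<mu>) \<le> ennreal level"
proof -
  have s [measurable_cong]: "sets \<mu> = sets borel" and "prob_space \<mu>"
    using st by (auto simp: stationary_distribution_def)
  then interpret prob_space \<mu> by simp
  have trunc: "(\<integral>x. min (real N) (V x) \<partial>\<mu>) \<le> level" for N :: nat
  proof -
    define f where "f x = min (real N) (V x)" for x
    have [measurable]: "f \<in> borel_measurable borel" unfolding f_def by measurable
    have fb: "\<bar>f x\<bar> \<le> real N" for x unfolding f_def using V_nonneg[of x] by auto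
    note it = iterate_measurable[OF \<open>f \<in> borel_measurable borel\<close>] iterate_bound[OF \<open>f \<in> borel_measurable borel\<close> fb]
    have le: "(T ^^ n) f x \<le> min (real N) (level + lam ^ n * V x)" for n x
    proof -
      have "(T ^^ n) f x \<le> level + 1 * lam ^ n * (V x - level)"
        by (rule iterate_drift[of f "real N"]) (use fb in \<open>auto simp: f_def\<close>)
      also have "\<dots> \<le> level + lam ^ n * V x"
        using lam level_nonneg by (simp add: algebra_simps)
      finally show ?thesis using it(2)[of n x] by simp
    qed
    have "(\<lambda>n. \<integral>x. min (real N) (level + lam ^ n * V x) \<partial>\<mu>) \<longlonglongrightarrow> (\<integral>x. min (real N) level \<partial>\<mu>)"
    proof (rule integral_dominated_convergence[where w="\<lambda>_. real N"])
      show "AE x in \<mu>. (\<lambda>n. min (real N) (level + lam ^ n * V x)) \<longlonglongrightarrow> min (real N) level"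
        using lam by (intro AE_I2) (auto intro!: tendsto_eq_intros LIMSEQ_power_zero)
      show "AE x in \<mu>. norm (min (real N) (level + lam ^ n * V x)) \<le> real N" for n
        using lam level_nonneg V_nonneg by (intro AE_I2) (auto simp: min_def)
    qed auto
    moreover have "(\<integral>x. f x \<partial>\<mu>) \<le> (\<integral>x. min (real N) (level + lam ^ n * V x) \<partial>\<mu>)" for n
    proof -
      have "(\<integral>x. f x \<partial>\<mu>) = (\<integral>x. (T ^^ n) f x \<partial>\<mu>)"
        by (rule stationary_integral_iterate[OF st _ fb, symmetric]) measurable
      also have "\<dots> \<le> (\<integral>x. min (real N) (level + lam ^ n * V x) \<partial>\<mu>)"
        using it le lam level_nonneg V_nonneg
        by (intro integral_mono integrable_const_bound[of _ "real N"] AE_I2) (auto simp: min_def)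
      finally show ?thesis .
    qed
    ultimately have "(\<integral>x. f x \<partial>\<mu>) \<le> (\<integral>x. min (real N) level \<partial>\<mu>)"
      by (intro LIMSEQ_le_const) auto
    also have "\<dots> \<le> level" using prob_space by simp
    finally show ?thesis unfolding f_def .
  qed
  have "(\<integral>\<^sup>+x. ennreal (V x) \<partial>\<mu>) = (\<integral>\<^sup>+x. (SUP N. ennreal (min (real N) (V x))) \<partial>\<mu>)"
  proof (intro nn_integral_cong antisym)
    fix x
    obtain N where "V x \<le> real N" using real_arch_simple by blast
    then have "min (real N) (V x) = V x" by simp
    then show "ennreal (V x) \<le> (SUP N. ennreal (min (real N) (V x)))"
      by (intro SUP_upper2[of N]) auto
  qed (auto intro!: SUP_least ennreal_leI)
  also have "\<dots> = (SUP N. \<integral>\<^sup>+x. ennreal (min (real N) (V x)) \<partial>\<mu>)"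
    by (intro nn_integral_monotone_convergence_SUP)
      (auto simp: incseq_def le_fun_def intro!: ennreal_leI min.mono)
  also have "\<dots> \<le> ennreal level"
  proof (rule SUP_least)
    fix N :: nat
    have "integrable \<mu> (\<lambda>x. min (real N) (V x))"
      by (rule integrable_const_bound[of _ "real N"]) (use V_nonneg in \<open>auto simp: min_def\<close>)
    then show "(\<integral>\<^sup>+x. ennreal (min (real N) (V x)) \<partial>\<mu>) \<le> ennreal level"
      using trunc[of N] V_nonneg by (subst nn_integral_eq_integral) (auto intro: ennreal_leI)
  qed
  finally show ?thesis .
qed

text \<open>A quantitative form of tightness. A function bounded below by \<open>a - k * V\<close> has averages that are
eventually almost \<open>a - k * level\<close>; taking \<open>a = t\<close> and \<open>k = t / M\<close>, this applies to any
nonnegative function that is at least \<open>t\<close> on the sublevel set \<open>{V \<le> M}\<close>.\<close>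

lemma average_drift:
  assumes f: "bounded_continuous f" and k: "0 \<le> k" and ge: "\<And>x. a - k * V x \<le> f x"
  shows "a - k * level - k * V x / (1 - lam) * (1 / real (Suc n)) \<le> average n f x"
proof -
  obtain B where B: "\<And>x. \<bar>- f x\<bar> \<le> B" using f by (metis bounded_continuousE abs_minus_cancel)
  have m: "(\<lambda>x. - f x) \<in> borel_measurable borel" using f by measurable
  have upper: "- f x \<le> (k * level - a) + k * (V x - level)" for x
    using ge[of x] by (simp add: algebra_simps)
  have minus: "(T ^^ i) (\<lambda>x. - f x) x = - (T ^^ i) f x" for i
    using iterate_cmult[of i "-1" f] by (simp add: fun_eq_iff)
  have it: "a - k * level - k * V x * lam ^ i \<le> (T ^^ i) f x" for i
  proof -
    have "- (T ^^ i) f x \<le> (k * level - a) + k * lam ^ i * (V x - level)"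
      using iterate_drift[OF m B k upper, of i x] minus by simp
    also have "\<dots> \<le> (k * level - a) + k * V x * lam ^ i"
      using k lam level_nonneg by (simp add: algebra_simps)
    finally show ?thesis by simp
  qed
  have geo: "(\<Sum>i\<le>n. lam ^ i) \<le> 1 / (1 - lam)"
    using lam by (simp add: sum_gp0 divide_right_mono)
  have "real (Suc n) * (a - k * level) - k * V x * (1 / (1 - lam))
      \<le> real (Suc n) * (a - k * level) - k * V x * (\<Sum>i\<le>n. lam ^ i)"
    using k V_nonneg by (intro diff_left_mono mult_left_mono geo) auto
  also have "\<dots> = (\<Sum>i\<le>n. a - k * level - k * V x * lam ^ i)"
    by (simp add: sum_subtractf sum_distrib_left)
  also have "\<dots> \<le> (\<Sum>i\<le>n. (T ^^ i) f x)" by (intro sum_mono it)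
  finally have "(real (Suc n) * (a - k * level) - k * V x * (1 / (1 - lam))) / real (Suc n) \<le> average n f x"
    unfolding average_def by (rule divide_right_mono) simp
  then show ?thesis by (simp add: diff_divide_distrib)
qed

end

locale feller_drift_kernel = drift_kernel +
  assumes feller: "weak_feller R"
    and compact_levels: "\<And>M. 0 < M \<Longrightarrow> compact {x. V x \<le> M}"
begin

lemma T_bounded_continuous: "bounded_continuous f \<Longrightarrow> bounded_continuous (T f)"
  using feller unfolding weak_feller_def bounded_continuous_def T_def[abs_def] by blast

section \<open>Existence of a stationary distribution\<close>

text \<open>The functionals \<open>a n\<close> are defined on all real functions, with value \<open>0\<close> where the average is not
needed, so that they lie in one product of compact intervals. Such a product is in general not
sequentially compact; \<open>H\<close> is a filter on functionals, finer than the tail filter of the sequence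
\<open>a\<close>, along which evaluation at each \<open>f\<close> tends to \<open>c f\<close>.\<close>

lemma stationary_exists: "\<exists>\<mu>. stationary_distribution borel R \<mu>"
proof -
  fix x0 :: 'a
  define a where "a n f = (if bounded_continuous f then average n f x0 else 0)" for n and f :: "'a \<Rightarrow> real"
  have "\<exists>B. \<forall>f :: 'a \<Rightarrow> real. bounded_continuous f \<longrightarrow> (\<forall>x. \<bar>f x\<bar> \<le> B f)"
    by (intro choice) (metis bounded_continuousE)
  then obtain B where B: "\<And>f :: 'a \<Rightarrow> real. bounded_continuous f \<Longrightarrow> (\<forall>x. \<bar>f x\<bar> \<le> B f)"
    by blast
  define K where "K = PiE UNIV (\<lambda>f :: 'a \<Rightarrow> real. {-\<bar>B f\<bar>..\<bar>B f\<bar>})"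
  have "compact K"
    unfolding K_def
    using compactin_PiE[of "\<lambda>_. euclidean" UNIV "\<lambda>f :: 'a \<Rightarrow> real. {-\<bar>B f\<bar>..\<bar>B f\<bar>}"]
    by (simp add: euclidean_product_topology)
  moreover have "a n \<in> K" for n
  proof -
    have "\<bar>a n f\<bar> \<le> \<bar>B f\<bar>" for f
    proof (cases "bounded_continuous f")
      case True
      then have "\<bar>average n f x0\<bar> \<le> B f"
        by (intro average_bound) (use B[OF True] True in \<open>auto intro: bounded_continuous_borel_measurable\<close>)
      then show ?thesis using True by (simp add: a_def)
    qed (simp add: a_def)
    then show ?thesis unfolding K_def by (auto simp: abs_le_iff minus_le_iff)
  qed
  ultimately obtain c where c: "inf (nhds c) (filtermap a sequentially) \<noteq> bot"
    unfolding compact_filter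
    by (metis (no_types, lifting) always_eventually eventually_filtermap filtermap_bot_iff sequentially_bot)
  define H where "H = inf (nhds c) (filtermap a sequentially)"
  have H: "H \<noteq> bot" using c by (simp add: H_def)
  have ev: "\<forall>\<^sub>F \<phi> in H. P \<phi>" if "\<And>n. P (a n)" for P
    unfolding H_def by (rule filter_leD[OF inf_le2]) (simp add: eventually_filtermap that)
  have lim: "((\<lambda>\<phi>. \<phi> f) \<longlongrightarrow> c f) H" for f
  proof -
    have "((\<lambda>\<phi>. \<phi> f) \<longlongrightarrow> c f) (nhds c)"
    proof (rule topological_tendstoI)
      fix S :: "real set" assume "open S" "c f \<in> S"
      then show "\<forall>\<^sub>F \<phi> in nhds c. \<phi> f \<in> S"
        using open_vimage[OF \<open>open S\<close> continuous_on_product_coordinates[of f]]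
        unfolding eventually_nhds by (intro exI[of _ "(\<lambda>\<phi>. \<phi> f) -` S"]) auto
    qed
    then show ?thesis unfolding H_def by (rule filterlim_mono[OF _ order_refl inf_le1])
  qed
  have seq: "((\<lambda>\<phi>. F \<phi>) \<longlongrightarrow> l) H" if "(\<lambda>n. F (a n)) \<longlonglongrightarrow> l" for F and l :: real
    unfolding H_def
    by (rule filterlim_mono[OF _ order_refl inf_le2]) (use that in \<open>simp add: filterlim_filtermap\<close>)
  note bc = bounded_continuous_intros
  have le_c: "l \<le> c f" if f: "bounded_continuous f" and b: "\<And>n. b n \<le> average n f x0" and "b \<longlonglongrightarrow> l" for f b l
  proof (rule field_le_epsilon)
    fix e :: real assume "0 < e"
    have "((\<lambda>\<phi>. max 0 (l - \<phi> f)) \<longlongrightarrow> 0) H"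
    proof (rule seq, rule tendsto_sandwich)
      show "\<forall>\<^sub>F n in sequentially. 0 \<le> max 0 (l - a n f)" by simp
      show "\<forall>\<^sub>F n in sequentially. max 0 (l - a n f) \<le> max 0 (l - b n)"
      proof (intro always_eventually allI)
        fix n
        show "max 0 (l - a n f) \<le> max 0 (l - b n)"
          using b[of n] f by (auto simp: a_def max_def)
      qed
      show "(\<lambda>n. max 0 (l - b n)) \<longlonglongrightarrow> 0"
        using \<open>b \<longlonglongrightarrow> l\<close> by (auto intro!: tendsto_eq_intros)
    qed simp
    moreover have "((\<lambda>\<phi>. max 0 (l - \<phi> f)) \<longlongrightarrow> max 0 (l - c f)) H"
      by (intro tendsto_intros lim)
    ultimately have "max 0 (l - c f) = 0" using tendsto_unique[OF H] by blast
    then show "l \<le> c f + e" using \<open>0 < e\<close> by auto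
  qed
  interpret mean: daniell_mean c
  proof
    fix f g :: "'a \<Rightarrow> real" assume fg: "bounded_continuous f" "bounded_continuous g"
    have "((\<lambda>\<phi>. \<phi> (\<lambda>x. f x + g x)) \<longlongrightarrow> c f + c g) H"
    proof (rule Lim_transform_eventually)
      show "((\<lambda>\<phi>. \<phi> f + \<phi> g) \<longlongrightarrow> c f + c g) H" by (intro tendsto_intros lim)
      show "\<forall>\<^sub>F \<phi> in H. \<phi> f + \<phi> g = \<phi> (\<lambda>x. f x + g x)"
        by (rule ev) (use fg in \<open>simp add: a_def average_add bc\<close>)
    qed
    with lim show "c (\<lambda>x. f x + g x) = c f + c g" using tendsto_unique[OF H] by blast
  next
    fix r and f :: "'a \<Rightarrow> real" assume f: "bounded_continuous f"
    have "((\<lambda>\<phi>. \<phi> (\<lambda>x. r * f x)) \<longlongrightarrow> r * c f) H"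
    proof (rule Lim_transform_eventually)
      show "((\<lambda>\<phi>. r * \<phi> f) \<longlongrightarrow> r * c f) H" by (intro tendsto_intros lim)
      show "\<forall>\<^sub>F \<phi> in H. r * \<phi> f = \<phi> (\<lambda>x. r * f x)"
        by (rule ev) (use f in \<open>simp add: a_def average_cmult bc\<close>)
    qed
    with lim show "c (\<lambda>x. r * f x) = r * c f" using tendsto_unique[OF H] by blast
  next
    fix f :: "'a \<Rightarrow> real" assume "bounded_continuous f" "\<And>x. 0 \<le> f x"
    then show "0 \<le> c f" by (intro le_c[of f "\<lambda>_. 0"] average_nonneg) auto
  next
    have "((\<lambda>\<phi>. \<phi> (\<lambda>x. 1)) \<longlongrightarrow> 1) H"
      by (rule seq) (simp add: a_def average_const bc)
    with lim show "c (\<lambda>x. 1) = 1" using tendsto_unique[OF H] by blast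
  next
    \<comment> \<open>On a compact sublevel set of \<open>V\<close> finitely many of the \<open>F i\<close> already sum to more than
      \<open>1 - e\<close>; by the drift, the averages of this partial sum \<open>S N\<close> are almost as large.\<close>
    fix F :: "nat \<Rightarrow> 'a \<Rightarrow> real"
    assume F: "\<And>i. bounded_continuous (F i)" "\<And>i x. 0 \<le> F i x" "\<And>x. 1 \<le> (\<Sum>i. ennreal (F i x))"
    define S where "S N x = (\<Sum>i<N. F i x)" for N x
    have S: "bounded_continuous (S N)" "0 \<le> S N x" for N x
      unfolding S_def[abs_def] using F(1,2) by (auto intro!: bc sum_nonneg)
    have S_mono: "S M x \<le> S N x" if "M \<le> N" for M N x
      unfolding S_def using that F(2) by (intro sum_mono2) auto
    have c_nonneg: "0 \<le> c f" if "bounded_continuous f" "\<And>x. 0 \<le> f x" for f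
      using that by (intro le_c[of f "\<lambda>_. 0"] average_nonneg) auto
    have c_S: "(\<Sum>i<N. c (F i)) = c (S N)" for N
    proof (induction N)
      case 0
      have "((\<lambda>\<phi>. \<phi> (\<lambda>x. 0)) \<longlongrightarrow> 0) H"
        by (rule seq) (simp add: a_def average_const bc)
      with lim[of "\<lambda>x. 0"] show ?case unfolding S_def[abs_def] using tendsto_unique[OF H] by auto
    next
      case (Suc N)
      have "((\<lambda>\<phi>. \<phi> (S (Suc N))) \<longlongrightarrow> c (S N) + c (F N)) H"
      proof (rule Lim_transform_eventually)
        show "((\<lambda>\<phi>. \<phi> (S N) + \<phi> (F N)) \<longlongrightarrow> c (S N) + c (F N)) H" by (intro tendsto_intros lim)
        have "S (Suc N) = (\<lambda>x. S N x + F N x)" by (simp add: S_def fun_eq_iff)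
        then show "\<forall>\<^sub>F \<phi> in H. \<phi> (S N) + \<phi> (F N) = \<phi> (S (Suc N))"
          by (intro ev) (use S F in \<open>simp add: a_def average_add bc\<close>)
      qed
      with lim[of "S (Suc N)"] show ?case using Suc tendsto_unique[OF H] by auto
    qed
    have approx: "\<exists>N. 1 - 2 * e \<le> c (S N)" if e: "0 < e" "e < 1" for e
    proof -
      \<comment> \<open>With this \<open>M\<close> the set \<open>{V > M}\<close> has long-run mass at most \<open>level / M \<le> e\<close>.\<close>
      define M where "M = level / e + 1"
      have M: "0 < M" "level / M \<le> e"
        unfolding M_def using level_nonneg e by (auto simp: field_simps add_pos_nonneg)
      have cover: "\<exists>N. 1 - e < S N x" for x
      proof (rule ccontr)
        assume "\<not> ?thesis"
        then have "(\<Sum>i<N. ennreal (F i x)) \<le> ennreal (1 - e)" for N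
          using F(2) by (simp add: S_def sum_ennreal not_less ennreal_leI)
        then have "(\<Sum>i. ennreal (F i x)) \<le> ennreal (1 - e)"
          by (intro suminf_le_const) auto
        then have "1 \<le> ennreal (1 - e)" using F(3)[of x] by (rule order_trans[rotated])
        then show False using e by simp
      qed
      obtain C where C: "finite C" "{x. V x \<le> M} \<subseteq> (\<Union>N\<in>C. {x. 1 - e < S N x})"
      proof (rule compactE_image[OF compact_levels[OF M(1)], of UNIV "\<lambda>N. {x. 1 - e < S N x}"])
        show "open {x. 1 - e < S N x}" for N
          using S(1)[of N] by (intro open_Collect_less) (auto simp: bounded_continuous_def)
      qed (use cover in auto)
      define N where "N = Max (insert 0 C)"
      have "1 - e \<le> S N x" if "V x \<le> M" for x
      proof -
        obtain N' where "N' \<in> C" "1 - e < S N' x" using C(2) \<open>V x \<le> M\<close> by blast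
        moreover from this have "S N' x \<le> S N x" unfolding N_def using C(1) by (intro S_mono) auto
        ultimately show ?thesis by simp
      qed
      then have base: "(1 - e) - (1 - e) / M * V x \<le> S N x" for x
      proof (cases "V x \<le> M")
        case True
        then show ?thesis using \<open>\<And>x. V x \<le> M \<Longrightarrow> 1 - e \<le> S N x\<close>[of x] e M V_nonneg[of x]
          by (smt (verit) divide_nonneg_pos mult_nonneg_nonneg)
      next
        case False
        then have "(1 - e) / M * M \<le> (1 - e) / M * V x" using e M by (intro mult_left_mono) auto
        then show ?thesis using S(2)[of N x] M by auto
      qed
      have "(1 - e) - (1 - e) / M * level \<le> c (S N)"
      proof (rule le_c[OF S(1)])
        show "(1 - e) - (1 - e) / M * level - (1 - e) / M * V x0 / (1 - lam) * (1 / real (Suc n)) \<le> average n (S N) x0" for n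
          using e M by (intro average_drift S base) auto
        show "(\<lambda>n. (1 - e) - (1 - e) / M * level - (1 - e) / M * V x0 / (1 - lam) * (1 / real (Suc n)))
            \<longlonglongrightarrow> (1 - e) - (1 - e) / M * level"
          by (rule tendsto_eq_intros LIMSEQ_Suc[OF lim_1_over_n] refl)+ simp
      qed
      moreover have "(1 - e) / M * level \<le> 1 * e"
        using mult_mono[of "1 - e" 1 "level / M" e] e M level_nonneg by simp
      ultimately show ?thesis by (intro exI[of _ N]) simp
    qed
    show "1 \<le> (\<Sum>i. ennreal (c (F i)))"
    proof (rule ennreal_le_epsilon)
      fix e :: real assume "0 < e"
      define e' where "e' = min (e / 2) (1 / 2)"
      have "0 < e'" "e' < 1" using \<open>0 < e\<close> by (auto simp: e'_def)
      then obtain N where N: "1 - 2 * e' \<le> c (S N)" using approx by blast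
      have "1 \<le> ennreal (c (S N) + e)"
        using N by (simp add: e'_def)
      also have "\<dots> = (\<Sum>i<N. ennreal (c (F i))) + ennreal e"
        using c_nonneg F \<open>0 < e\<close> by (subst sum_ennreal) (auto simp: c_S S intro!: ennreal_plus c_nonneg)
      also have "\<dots> \<le> (\<Sum>i. ennreal (c (F i))) + ennreal e"
        by (intro add_right_mono sum_le_suminf) auto
      finally show "1 \<le> (\<Sum>i. ennreal (c (F i))) + ennreal e" .
    qed
  qed
  have "c (T f) = c f" if f: "bounded_continuous f" for f
  proof -
    obtain B where B: "\<And>x. \<bar>f x\<bar> \<le> B" using f by (metis bounded_continuousE)
    have "((\<lambda>\<phi>. \<phi> (T f) - \<phi> f) \<longlongrightarrow> 0) H"
      by (rule seq) (use average_T_tendsto[OF bounded_continuous_borel_measurable[OF f] B] f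
          T_bounded_continuous[OF f] in \<open>simp add: a_def\<close>)
    moreover have "((\<lambda>\<phi>. \<phi> (T f) - \<phi> f) \<longlongrightarrow> c (T f) - c f) H" by (intro tendsto_intros lim)
    ultimately have "c (T f) - c f = 0" using tendsto_unique[OF H] by blast
    then show ?thesis by simp
  qed
  then have "stationary_distribution borel R mean.representing_measure"
    by (intro stationaryI mean.prob_space_representing_measure mean.sets_representing_measure) (simp add: mean.integral_representing_measure T_bounded_continuous)
  then show ?thesis ..
qed

section \<open>Harmonic functions and uniqueness\<close>

text \<open>The long-run mass of \<open>{V > M}\<close> is at most one half for \<open>M = 2 * level + 1\<close>. If the supremum \<open>s\<close> were
not attained, \<open>h\<close> would stay below some \<open>t < s\<close> on the compact set \<open>{V \<le> M}\<close>, and averaging with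
\<open>h = T\<^sup>n h\<close> would give \<open>h \<le> (s + t) / 2\<close> everywhere.\<close>

lemma harmonic_attains_sup:
  assumes h: "bounded_continuous h" and harm: "T h = h"
  shows "\<exists>x. \<forall>y. h y \<le> h x"
proof (rule ccontr)
  assume no_max: "\<not> ?thesis"
  obtain B where B: "\<And>x. \<bar>h x\<bar> \<le> B" using h by (metis bounded_continuousE)
  define s where "s = (SUP x. h x)"
  have bdd: "bdd_above (range h)" using B by (auto intro!: bdd_aboveI2[of _ _ B] simp: abs_le_iff)
  have le_s: "h x \<le> s" for x unfolding s_def using bdd by (intro cSUP_upper) auto
  have lt_s: "h x < s" for x
    using no_max le_s by (metis dual_order.trans less_eq_real_def)
  define M where "M = 2 * level + 1"
  have M: "0 < M" "level / M \<le> 1 / 2"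
    unfolding M_def using level_nonneg by (auto simp: field_simps)
  have "\<exists>t<s. \<forall>x\<in>{x. V x \<le> M}. h x \<le> t"
  proof (cases "{x. V x \<le> M} = {}")
    case True
    then show ?thesis by (metis empty_iff lt_s)
  next
    case False
    then obtain x where "\<forall>y\<in>{x. V x \<le> M}. h y \<le> h x"
      using continuous_attains_sup[OF compact_levels[OF M(1)] False, of h] h
      by (metis bounded_continuous_def continuous_on_subset subset_UNIV)
    then show ?thesis using lt_s by blast
  qed
  then obtain t where t: "t < s" "\<And>x. V x \<le> M \<Longrightarrow> h x \<le> t" by blast
  define k where "k = (s - t) / M"
  have k: "0 \<le> k" "k * M = s - t" unfolding k_def using t M by auto
  have base: "h x \<le> (t + k * level) + k * (V x - level)" for x
  proof (cases "V x \<le> M")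
    case True
    then show ?thesis using t(2)[of x] k(1) V_nonneg[of x] by (simp add: algebra_simps add_increasing2)
  next
    case False
    then have "k * M \<le> k * V x" using k(1) by (intro mult_left_mono) auto
    then show ?thesis using le_s[of x] k(2) by (simp add: algebra_simps)
  qed
  have harm_n: "(T ^^ n) h = h" for n by (induction n) (simp_all add: harm)
  have bound: "h x \<le> t + k * level" for x
  proof (rule LIMSEQ_le_const)
    show "(\<lambda>n. (t + k * level) + k * lam ^ n * (V x - level)) \<longlonglongrightarrow> t + k * level"
      using lam by (auto intro!: tendsto_eq_intros LIMSEQ_power_zero)
    show "\<exists>N. \<forall>n\<ge>N. h x \<le> (t + k * level) + k * lam ^ n * (V x - level)"
      using iterate_drift[OF bounded_continuous_borel_measurable[OF h] B k(1) base, of _ x] harm_n by auto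
  qed
  have "k * level \<le> (s - t) * (1 / 2)"
    unfolding k_def using M t(1) mult_left_mono[OF M(2), of "s - t"] by simp
  then have "h x \<le> (s + t) / 2" for x using bound[of x] by (simp add: field_simps)
  then have "s \<le> (s + t) / 2" unfolding s_def[of] by (intro cSUP_least) auto
  with t(1) show False by simp
qed

text \<open>Where \<open>h\<close> is maximal, \<open>T h = h\<close> forces the next state to be almost surely a maximum point too.\<close>

lemma harmonic_max_reachable:
  assumes h: "bounded_continuous h" and harm: "T h = h" and x0: "reachable_point R x0"
  shows "h y \<le> h x0"
proof -
  obtain x where x: "\<And>y. h y \<le> h x" using harmonic_attains_sup[OF h harm] by auto
  obtain B where B: "\<And>x. \<bar>h x\<bar> \<le> B" using h by (metis bounded_continuousE)
  have [measurable]: "h \<in> borel_measurable borel" using h by measurable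
  have "x0 \<in> {z. h z = h x}"
  proof (rule reachable_in_absorbing[OF x0])
    show "closed {z. h z = h x}"
      using h by (intro closed_Collect_eq) (auto simp: bounded_continuous_def)
    fix z assume z: "z \<in> {z. h z = h x}"
    interpret prob_space "R z" by (rule prob_space_kernel)
    have pu: "prob UNIV = 1" using prob_space by simp
    have int: "integrable (R z) h" by (rule integrable_kernel[OF _ B]) simp
    have "(\<integral>w. h x - h w \<partial>R z) = h x - T h z"
      using int by (simp add: pu T_def)
    also have "\<dots> = 0" using harm z by simp
    finally have "AE w in R z. h x - h w = 0"
      using int x by (subst (asm) integral_nonneg_eq_0_iff_AE) auto
    then show "AE w in R z. w \<in> {z. h z = h x}" by (auto elim!: eventually_mono)
  qed auto
  with x show ?thesis by simp
qed

lemma harmonic_constant: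
  assumes h: "bounded_continuous h" and harm: "T h = h" and x0: "reachable_point R x0"
  shows "h y = h x0"
proof (rule antisym)
  show "h y \<le> h x0" by (rule harmonic_max_reachable[OF assms])
  have "T (\<lambda>x. - h x) = (\<lambda>x. - h x)"
    using iterate_cmult[of 1 "-1" h] harm by simp
  then have "- h y \<le> - h x0"
    using bounded_continuous_cmult[OF h, of "-1"] by (intro harmonic_max_reachable[OF _ _ x0]) auto
  then show "h x0 \<le> h y" by simp
qed

text \<open>The limit \<open>h\<close> of averages of \<open>f\<close> along a subsequence is harmonic, hence a constant. Every
stationary law integrates all averages of \<open>f\<close> to the integral of \<open>f\<close>, so that this integral is
the constant.\<close>

lemma stationary_unique:
  assumes x0: "reachable_point R x0"
    and equi: "\<And>f L x e. bounded_continuous f \<Longrightarrow> (\<And>x y. \<bar>f x - f y\<bar> \<le> L * dist x y) \<Longrightarrow> 0 < e \<Longrightarrow>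
      \<exists>d>0. \<forall>n y. dist x y < d \<longrightarrow> \<bar>(T ^^ n) f x - (T ^^ n) f y\<bar> < e"
    and st: "stationary_distribution borel R \<mu>" "stationary_distribution borel R \<mu>'"
  shows "\<mu> = \<mu>'"
proof (rule prob_measure_eqI_lipschitz)
  fix f :: "'a \<Rightarrow> real" and L :: real assume f: "bounded_continuous f" and lip: "\<And>x y. \<bar>f x - f y\<bar> \<le> L * dist x y"
  obtain B where B: "\<And>x. \<bar>f x\<bar> \<le> B" using f by (metis bounded_continuousE)
  have [measurable]: "f \<in> borel_measurable borel" using f by measurable
  note avg = average_measurable[OF \<open>f \<in> borel_measurable borel\<close>]
    average_bound[OF \<open>f \<in> borel_measurable borel\<close> B]
  have "\<exists>d>0. \<forall>n y. dist x y < d \<longrightarrow> \<bar>average n f x - average n f y\<bar> < e" if "0 < e" for x e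
  proof -
    obtain d where d: "0 < d" "\<And>n y. dist x y < d \<Longrightarrow> \<bar>(T ^^ n) f x - (T ^^ n) f y\<bar> < e"
      using equi[OF f lip \<open>0 < e\<close>, of x] by auto
    have "\<bar>average n f x - average n f y\<bar> < e" if "dist x y < d" for n y
    proof -
      have "\<bar>\<Sum>k\<le>n. (T ^^ k) f x - (T ^^ k) f y\<bar> \<le> (\<Sum>k\<le>n. \<bar>(T ^^ k) f x - (T ^^ k) f y\<bar>)"
        by (rule sum_abs)
      also have "\<dots> < (\<Sum>k\<le>n. e)"
        using d(2)[OF that] by (intro sum_strict_mono) auto
      finally show ?thesis
        unfolding average_def
        by (simp add: diff_divide_distrib[symmetric] sum_subtractf[symmetric] abs_divide
            pos_divide_less_eq mult.commute)
    qed
    with d(1) show ?thesis by blast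
  qed
  then obtain r h where r: "strict_mono (r :: nat \<Rightarrow> nat)" and h: "\<And>x. (\<lambda>n. average (r n) f x) \<longlonglongrightarrow> h x"
    and cont: "continuous_on UNIV h"
    using equicontinuous_convergent_subsequence[of "\<lambda>n. average n f" B] avg(2) by metis
  have hB: "\<bar>h x\<bar> \<le> B" for x
    by (rule LIMSEQ_le_const2[OF tendsto_rabs[OF h]]) (use avg(2) in auto)
  have bh: "bounded_continuous h" by (rule bounded_continuousI[OF cont hB])
  have [measurable]: "h \<in> borel_measurable borel" using bh by measurable
  have lim: "(\<lambda>n. \<integral>x. average (r n) f x \<partial>P) \<longlonglongrightarrow> (\<integral>x. h x \<partial>P)"
    if "prob_space P" "sets P = sets borel" for P
  proof -
    interpret prob_space P by fact
    note [measurable_cong] = that(2)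
    show ?thesis
      by (rule integral_dominated_convergence[where w="\<lambda>_. B"]) (use avg h in auto)
  qed
  have "T h = h"
  proof
    fix x
    have "(\<lambda>n. average (r n) (T f) x - average (r n) f x) \<longlonglongrightarrow> 0"
      using LIMSEQ_subseq_LIMSEQ[OF average_T_tendsto[OF \<open>f \<in> borel_measurable borel\<close> B] r]
      by (simp add: o_def)
    from tendsto_add[OF this h[of x]] have "(\<lambda>n. average (r n) (T f) x) \<longlonglongrightarrow> h x" by simp
    moreover have "(\<lambda>n. average (r n) (T f) x) \<longlonglongrightarrow> T h x"
      using lim[OF prob_space_kernel sets_kernel_eq, of x]
      by (simp add: T_average[OF \<open>f \<in> borel_measurable borel\<close> B, symmetric] T_def)
    ultimately show "T h x = h x" by (rule LIMSEQ_unique[rotated])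
  qed
  then have const: "h = (\<lambda>_. h x0)" using harmonic_constant[OF bh _ x0] by auto
  have "(\<integral>x. f x \<partial>P) = h x0" if P: "stationary_distribution borel R P" for P
  proof -
    have p: "prob_space P" "sets P = sets borel"
      using P by (auto simp: stationary_distribution_def)
    have "(\<integral>x. h x \<partial>P) = h x0"
      by (subst const) (simp add: prob_space.prob_space[OF p(1)])
    with lim[OF p] show ?thesis
      by (simp add: stationary_integral_average[OF P \<open>f \<in> borel_measurable borel\<close> B] LIMSEQ_const_iff)
  qed
  with st show "(\<integral>x. f x \<partial>\<mu>) = (\<integral>x. f x \<partial>\<mu>')" by simp
qed (use st in \<open>auto simp: stationary_distribution_def\<close>)

end

section \<open>Stationary laws of the joint chain and of the state chain\<close>

context dominated_observation_driven_model
begin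

abbreviation "G \<equiv> obs_kernel \<nu> g"
abbreviation "K \<equiv> joint_kernel \<nu> g \<psi>"
abbreviation "R \<equiv> state_kernel \<nu> g \<psi>"

lemma sets_G [simp, measurable_cong]: "sets (G x) = sets \<nu>"
  by (simp add: obs_kernel_def)

lemma space_G [simp]: "space (G x) = space \<nu>"
  by (simp add: obs_kernel_def)

lemma prob_space_G: "prob_space (G x)"
  using measurable_space[OF obs_kernel_measurable, of x] by (simp add: space_prob_algebra)

lemma \<psi>_measurable2 [measurable]: "(\<lambda>y. \<psi> y x) \<in> \<nu> \<rightarrow>\<^sub>M borel"
  using measurable_compose[OF measurable_Pair1' \<psi>_measurable, of x] by simp

declare g_measurable [measurable]

lemma R_kernel: "R \<in> borel \<rightarrow>\<^sub>M prob_algebra borel"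
  unfolding state_kernel_def[abs_def]
  by (rule measurable_distr_prob_space2[OF obs_kernel_measurable \<psi>_measurable])

sublocale state: markov_kernel R
  by standard (rule R_kernel)

lemma g_nonneg: "y \<in> space \<nu> \<Longrightarrow> 0 \<le> g x y"
  using g_pos[of y x] by simp

lemma integrable_G_iff:
  fixes f :: "'b \<Rightarrow> real"
  shows "f \<in> borel_measurable \<nu> \<Longrightarrow> integrable (G x) f \<longleftrightarrow> integrable \<nu> (\<lambda>y. g x y * f y)"
  unfolding obs_kernel_def by (subst integrable_density) (auto simp: g_nonneg)

lemma integral_G:
  fixes f :: "'b \<Rightarrow> real"
  shows "f \<in> borel_measurable \<nu> \<Longrightarrow> (\<integral>y. f y \<partial>G x) = (\<integral>y. g x y * f y \<partial>\<nu>)"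
  unfolding obs_kernel_def by (subst integral_density) (auto simp: g_nonneg)

lemma integrable_g: "integrable \<nu> (g x)" and integral_g: "(\<integral>y. g x y \<partial>\<nu>) = 1"
proof -
  interpret G: prob_space "G x" by (rule prob_space_G)
  show "integrable \<nu> (g x)" using integrable_G_iff[of "\<lambda>_. 1" x] by simp
  show "(\<integral>y. g x y \<partial>\<nu>) = 1"
    using integral_G[of "\<lambda>_. 1" x] G.prob_space by simp
qed

lemma integrable_g_bounded:
  fixes f :: "'b \<Rightarrow> real"
  assumes [measurable]: "f \<in> borel_measurable \<nu>" and "\<And>y. \<bar>f y\<bar> \<le> B"
  shows "integrable \<nu> (\<lambda>y. g x y * f y)"
proof -
  interpret G: prob_space "G x" by (rule prob_space_G)
  show ?thesis
    using assms by (subst integrable_G_iff[symmetric]) (auto intro!: G.integrable_const_bound[of _ B])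
qed

lemma T_eq:
  assumes [measurable]: "h \<in> borel_measurable borel"
  shows "state.T h x = (\<integral>y. g x y * h (\<psi> y x) \<partial>\<nu>)"
  unfolding state.T_def state_kernel_def by (simp add: integral_distr integral_G)

text \<open>The law of the pair of a state and an observation drawn from it. The joint kernel first updates
the state and then applies this kernel.\<close>

definition pair_kernel :: "'a \<Rightarrow> ('a \<times> 'b) measure" where
  "pair_kernel x = distr (G x) (borel \<Otimes>\<^sub>M \<nu>) (Pair x)"

lemma pair_kernel_measurable: "pair_kernel \<in> borel \<rightarrow>\<^sub>M prob_algebra (borel \<Otimes>\<^sub>M \<nu>)"
  unfolding pair_kernel_def[abs_def]
  by (rule measurable_distr_prob_space2[OF obs_kernel_measurable]) simp

lemma pair_kernel_subprob [measurable]: "pair_kernel \<in> borel \<rightarrow>\<^sub>M subprob_algebra (borel \<Otimes>\<^sub>M \<nu>)"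
  by (rule measurable_prob_algebraD[OF pair_kernel_measurable])

lemma joint_kernel_eq: "K (x, y) = pair_kernel (\<psi> y x)"
  unfolding joint_kernel_def by (simp flip: pair_kernel_def add: bind_return[OF pair_kernel_subprob])

lemma nn_integral_pair_kernel:
  assumes [measurable]: "f \<in> borel_measurable (borel \<Otimes>\<^sub>M \<nu>)"
  shows "(\<integral>\<^sup>+z. f z \<partial>pair_kernel x) = (\<integral>\<^sup>+y. f (x, y) \<partial>G x)"
  unfolding pair_kernel_def by (subst nn_integral_distr) auto

lemma nn_integral_R:
  assumes [measurable]: "f \<in> borel_measurable borel"
  shows "(\<integral>\<^sup>+x'. f x' \<partial>R x) = (\<integral>\<^sup>+y. f (\<psi> y x) \<partial>G x)"
  unfolding state_kernel_def by (subst nn_integral_distr) auto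

text \<open>One step of the joint chain turns \<open>\<pi>\<close> into the law obtained by updating the state, with some law
\<open>\<eta>\<close>, and drawing an observation from it. By stationarity \<open>\<eta>\<close> is the state marginal \<open>\<mu>\<close> of \<open>\<pi>\<close>,
which gives the disintegration of \<open>\<pi>\<close>; inserting it into the definition of \<open>\<eta>\<close> shows that \<open>\<mu>\<close> is
stationary for \<open>R\<close>.\<close>

lemma stationary_joint_imp:
  assumes st: "stationary_distribution (borel \<Otimes>\<^sub>M \<nu>) K \<pi>"
  defines "\<mu> \<equiv> distr \<pi> borel fst"
  shows "stationary_distribution borel R \<mu>" and "\<pi> = \<mu> \<bind> pair_kernel"
proof -
  have p: "prob_space \<pi>" and s [measurable_cong]: "sets \<pi> = sets (borel \<Otimes>\<^sub>M \<nu>)"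
    and inv: "\<And>A. A \<in> sets (borel \<Otimes>\<^sub>M \<nu>) \<Longrightarrow> (\<integral>\<^sup>+z. emeasure (K z) A \<partial>\<pi>) = emeasure \<pi> A"
    using st by (auto simp: stationary_distribution_def)
  interpret prob_space \<pi> by (rule p)
  have sp: "space \<pi> = UNIV \<times> space \<nu>"
    using sets_eq_imp_space_eq[OF s] by (simp add: space_pair_measure)
  note [measurable] = \<psi>_measurable
  have [measurable]: "(\<lambda>z. \<psi> (snd z) (fst z)) \<in> borel \<Otimes>\<^sub>M \<nu> \<rightarrow>\<^sub>M borel"
    using \<psi>_measurable by (simp add: case_prod_unfold)
  define \<eta> where "\<eta> = distr \<pi> borel (\<lambda>z. \<psi> (snd z) (fst z))"
  have em: "emeasure \<pi> A = (\<integral>\<^sup>+x. emeasure (pair_kernel x) A \<partial>\<eta>)" if A [measurable]: "A \<in> sets (borel \<Otimes>\<^sub>M \<nu>)" for A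
  proof -
    have "emeasure \<pi> A = (\<integral>\<^sup>+z. emeasure (pair_kernel (\<psi> (snd z) (fst z))) A \<partial>\<pi>)"
      unfolding inv[OF A, symmetric]
      by (intro nn_integral_cong) (metis joint_kernel_eq prod.collapse)
    also have "\<dots> = (\<integral>\<^sup>+x. emeasure (pair_kernel x) A \<partial>\<eta>)"
      unfolding \<eta>_def
      by (subst nn_integral_distr) (auto intro!: measurable_compose[OF pair_kernel_subprob] A)
    finally show ?thesis .
  qed
  have "\<mu> = \<eta>"
  proof (rule measure_eqI)
    fix B assume "B \<in> sets \<mu>"
    then have B [measurable]: "B \<in> sets borel" by (simp add: \<mu>_def)
    have "emeasure \<mu> B = emeasure \<pi> (B \<times> space \<nu>)"
      unfolding \<mu>_def by (subst emeasure_distr) (auto simp: sp intro!: arg_cong[where f="emeasure \<pi>"])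
    also have "\<dots> = (\<integral>\<^sup>+x. emeasure (pair_kernel x) (B \<times> space \<nu>) \<partial>\<eta>)"
      by (rule em) simp
    also have "\<dots> = (\<integral>\<^sup>+x. indicator B x \<partial>\<eta>)"
    proof (rule nn_integral_cong)
      fix x
      have "Pair x -` (B \<times> space \<nu>) \<inter> space (G x) = (if x \<in> B then space \<nu> else {})" by auto
      then show "emeasure (pair_kernel x) (B \<times> space \<nu>) = indicator B x"
        using prob_space.emeasure_space_1[OF prob_space_G, of x]
        unfolding pair_kernel_def by (subst emeasure_distr) auto
    qed
    finally show "emeasure \<mu> B = emeasure \<eta> B" by (simp add: \<eta>_def)
  qed (simp add: \<mu>_def \<eta>_def)
  have p\<mu>: "prob_space \<mu>" and s\<mu> [measurable_cong, simp]: "sets \<mu> = sets borel"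
    unfolding \<mu>_def by (auto intro!: prob_space_distr)
  have sp\<mu>: "space \<mu> \<noteq> {}" by (simp add: \<mu>_def)
  show \<pi>_eq: "\<pi> = \<mu> \<bind> pair_kernel"
  proof (rule measure_eqI)
    have sb: "sets (\<mu> \<bind> pair_kernel) = sets (borel \<Otimes>\<^sub>M \<nu>)"
      by (rule sets_bind) (auto simp: sp\<mu> pair_kernel_def)
    then show "sets \<pi> = sets (\<mu> \<bind> pair_kernel)" using s by simp
    fix A assume "A \<in> sets \<pi>"
    then have A: "A \<in> sets (borel \<Otimes>\<^sub>M \<nu>)" by (simp add: s)
    show "emeasure \<pi> A = emeasure (\<mu> \<bind> pair_kernel) A"
      unfolding em[OF A] \<open>\<mu> = \<eta>\<close>[symmetric]
      by (rule emeasure_bind[of _ _ "borel \<Otimes>\<^sub>M \<nu>", symmetric]) (auto simp: sp\<mu> A)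
  qed
  show "stationary_distribution borel R \<mu>"
    unfolding stationary_distribution_def
  proof (intro conjI ballI p\<mu> s\<mu>)
    fix B :: "'a set" assume B [measurable]: "B \<in> sets borel"
    have "emeasure \<mu> B = (\<integral>\<^sup>+x. indicator B x \<partial>\<eta>)"
      unfolding \<open>\<mu> = \<eta>\<close> by (simp add: \<eta>_def)
    also have "\<dots> = (\<integral>\<^sup>+z. indicator B (\<psi> (snd z) (fst z)) \<partial>\<pi>)"
      unfolding \<eta>_def by (rule nn_integral_distr) auto
    also have "\<dots> = (\<integral>\<^sup>+x. \<integral>\<^sup>+z. indicator B (\<psi> (snd z) (fst z)) \<partial>pair_kernel x \<partial>\<mu>)"
      by (subst \<pi>_eq, rule nn_integral_bind[of _ "borel \<Otimes>\<^sub>M \<nu>"]) auto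
    also have "\<dots> = (\<integral>\<^sup>+x. emeasure (R x) B \<partial>\<mu>)"
      by (intro nn_integral_cong) (simp add: nn_integral_pair_kernel nn_integral_R flip: nn_integral_indicator)
    finally show "(\<integral>\<^sup>+x. emeasure (R x) B \<partial>\<mu>) = emeasure \<mu> B" by simp
  qed
qed

lemma stationary_joint_of_state:
  assumes st: "stationary_distribution borel R \<mu>"
  shows "stationary_distribution (borel \<Otimes>\<^sub>M \<nu>) K (\<mu> \<bind> pair_kernel)"
proof -
  have p: "prob_space \<mu>" and s [measurable_cong, simp]: "sets \<mu> = sets borel"
    using st by (auto simp: stationary_distribution_def)
  have ne: "space \<mu> \<noteq> {}" using p by (rule prob_space.not_empty)
  note [measurable] = \<psi>_measurable
  have m [measurable]: "(\<lambda>z. \<psi> (snd z) (fst z)) \<in> borel \<Otimes>\<^sub>M \<nu> \<rightarrow>\<^sub>M borel"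
    using \<psi>_measurable by (simp add: case_prod_unfold)
  show ?thesis
    unfolding stationary_distribution_def
  proof (intro conjI ballI)
    have "\<mu> \<in> space (prob_algebra borel)" using p by (simp add: space_prob_algebra)
    then show "prob_space (\<mu> \<bind> pair_kernel)" "sets (\<mu> \<bind> pair_kernel) = sets (borel \<Otimes>\<^sub>M \<nu>)"
      by (rule prob_space_bind'[OF _ pair_kernel_measurable], rule sets_bind'[OF _ pair_kernel_measurable])
    fix A :: "('a \<times> 'b) set" assume A [measurable]: "A \<in> sets (borel \<Otimes>\<^sub>M \<nu>)"
    have [measurable]: "(\<lambda>x. emeasure (pair_kernel x) A) \<in> borel_measurable borel"
      by (rule measurable_compose[OF pair_kernel_subprob]) (use A in auto)
    have [measurable]: "(\<lambda>z. emeasure (pair_kernel (\<psi> (snd z) (fst z))) A) \<in> borel_measurable (borel \<Otimes>\<^sub>M \<nu>)"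
      using measurable_compose[OF m \<open>(\<lambda>x. emeasure (pair_kernel x) A) \<in> borel_measurable borel\<close>] by simp
    have "(\<integral>\<^sup>+z. emeasure (K z) A \<partial>(\<mu> \<bind> pair_kernel))
        = (\<integral>\<^sup>+z. emeasure (pair_kernel (\<psi> (snd z) (fst z))) A \<partial>(\<mu> \<bind> pair_kernel))"
      by (intro nn_integral_cong) (metis joint_kernel_eq prod.collapse)
    also have "\<dots> = (\<integral>\<^sup>+x. \<integral>\<^sup>+z. emeasure (pair_kernel (\<psi> (snd z) (fst z))) A \<partial>pair_kernel x \<partial>\<mu>)"
      by (rule nn_integral_bind[of _ "borel \<Otimes>\<^sub>M \<nu>"]) auto
    also have "\<dots> = (\<integral>\<^sup>+x. \<integral>\<^sup>+x'. emeasure (pair_kernel x') A \<partial>R x \<partial>\<mu>)"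
      by (intro nn_integral_cong) (simp add: nn_integral_pair_kernel nn_integral_R)
    also have "\<dots> = (\<integral>\<^sup>+x'. emeasure (pair_kernel x') A \<partial>(\<mu> \<bind> R))"
      by (rule nn_integral_bind[of _ borel, symmetric]) auto
    also have "\<dots> = emeasure (\<mu> \<bind> pair_kernel) A"
      unfolding state.stationary_bind[OF st]
      by (rule emeasure_bind[of _ _ "borel \<Otimes>\<^sub>M \<nu>", symmetric]) (auto simp: ne)
    finally show "(\<integral>\<^sup>+z. emeasure (K z) A \<partial>(\<mu> \<bind> pair_kernel)) = emeasure (\<mu> \<bind> pair_kernel) A" .
  qed
qed

end

section \<open>Equicontinuity by coupling observations\<close>

text \<open>The contraction and drift conditions with explicit real constants \<open>\<rho>\<close> and \<open>C\<close> in place of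
suprema.\<close>

locale coupled_observation_model = dominated_observation_driven_model \<nu> g \<psi>
  for \<nu> :: "'b measure" and g :: "'a :: polish_space \<Rightarrow> 'b \<Rightarrow> real" and \<psi> :: "'b \<Rightarrow> 'a \<Rightarrow> 'a" +
  fixes \<rho> C :: real and \<alpha> W :: "'a \<times> 'a \<Rightarrow> real" and \<phi> :: "'a \<times> 'a \<Rightarrow> 'a"
  assumes \<rho>: "0 \<le> \<rho>" "\<rho> < 1"
    and contraction: "\<And>x x' y. y \<in> space \<nu> \<Longrightarrow> dist (\<psi> y x) (\<psi> y x') \<le> \<rho> * dist x x'"
    and C: "0 \<le> C"
    and \<alpha>: "\<And>p. \<alpha> p \<in> {0..1}"
    and W_measurable [measurable]: "W \<in> borel_measurable (borel \<Otimes>\<^sub>M borel)" and W_ge_1: "\<And>p. 1 \<le> W p"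
    and overlap: "\<And>x x' y. y \<in> space \<nu> \<Longrightarrow> \<alpha> (x, x') * g (\<phi> (x, x')) y \<le> min (g x y) (g x' y)"
    and W_locally_bounded: "\<And>x. \<exists>\<gamma>>0. \<exists>w. \<forall>x'\<in>ball x \<gamma>. W (x, x') \<le> w"
    and failure: "\<And>x x'. 1 - \<alpha> (x, x') \<le> dist x x' * W (x, x')"
    and W_drift: "\<And>x x'. (\<integral>\<^sup>+y. ennreal (W (\<psi> y x, \<psi> y x')) \<partial>G (\<phi> (x, x'))) \<le> ennreal (W (x, x') + C)"
begin

lemma W_nonneg: "0 \<le> W p"
  using W_ge_1[of p] by simp

text \<open>Split \<open>g x = a * g m + (g x - a * g m)\<close>, and likewise for \<open>x'\<close>, where \<open>a = \<alpha> (x, x')\<close> and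
\<open>m = \<phi> (x, x')\<close>. On the common part the two updated states are compared through the modulus of
\<open>h\<close>; there the distance gains the factor \<open>\<rho>\<close> and the mean of \<open>W\<close> loses at most \<open>C\<close>. Each of the two
remainders has mass \<open>1 - a \<le> dist x x' * W (x, x')\<close>, and on them only \<open>\<bar>h\<bar> \<le> B\<close> is used.\<close>

lemma coupling_step:
  assumes h [measurable]: "h \<in> borel_measurable borel" and hB: "\<And>x. \<bar>h x\<bar> \<le> B"
    and pq: "0 \<le> p" "0 \<le> q"
    and mod: "\<And>z z'. \<bar>h z - h z'\<bar> \<le> dist z z' * (p + q * W (z, z'))"
  shows "\<bar>state.T h x - state.T h x'\<bar>
    \<le> dist x x' * (\<rho> * p + \<rho> * q * (W (x, x') + C) + 2 * B * W (x, x'))"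
proof -
  define D where "D = dist x x'"
  define m where "m = \<phi> (x, x')"
  define a where "a = \<alpha> (x, x')"
  define w where "w = W (x, x')"
  define U where "U y = W (\<psi> y x, \<psi> y x')" for y
  have a: "0 \<le> a" "a \<le> 1" using \<alpha>[of "(x, x')"] by (auto simp: a_def)
  have B: "0 \<le> B" using hB[of x] by simp
  have [measurable]: "U \<in> borel_measurable \<nu>"
    unfolding U_def using measurable_compose[of "\<lambda>y. (\<psi> y x, \<psi> y x')" \<nu> _ W] by simp
  have U: "0 \<le> U y" for y by (simp add: U_def W_nonneg)
  have intU: "integrable (G m) U"
    using W_drift[of x x'] U unfolding U_def m_def[symmetric]
    by (intro integrableI_nonneg) (auto simp: le_less_trans simp flip: U_def)
  have "ennreal (\<integral>y. U y \<partial>G m) \<le> ennreal (w + C)"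
    using W_drift[of x x'] nn_integral_eq_integral[OF intU] U
    unfolding m_def[symmetric] w_def[symmetric] U_def[symmetric] by simp
  then have U_le: "(\<integral>y. U y \<partial>G m) \<le> w + C"
    using C W_nonneg[of "(x, x')"] by (subst (asm) ennreal_le_iff) (auto simp: w_def)
  have int_gU: "integrable \<nu> (\<lambda>y. g m y * U y)" using intU by (simp add: integrable_G_iff)
  have int: "integrable \<nu> (\<lambda>y. g z y * h (\<psi> y z'))" for z z'
    by (rule integrable_g_bounded[of _ B]) (use hB in auto)
  have "\<bar>state.T h x - state.T h x'\<bar> = \<bar>\<integral>y. g x y * h (\<psi> y x) - g x' y * h (\<psi> y x') \<partial>\<nu>\<bar>"
    using int by (simp add: T_eq)
  also have "\<dots> \<le> (\<integral>y. \<bar>g x y * h (\<psi> y x) - g x' y * h (\<psi> y x')\<bar> \<partial>\<nu>)"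
    by (rule integral_abs_bound)
  also have "\<dots> \<le> (\<integral>y. a * (\<rho> * D * (p * g m y + q * (g m y * U y)))
      + B * (g x y + g x' y - 2 * a * g m y) \<partial>\<nu>)"
  proof (rule integral_mono)
    show "integrable \<nu> (\<lambda>y. \<bar>g x y * h (\<psi> y x) - g x' y * h (\<psi> y x')\<bar>)"
      using int by auto
    show "integrable \<nu> (\<lambda>y. a * (\<rho> * D * (p * g m y + q * (g m y * U y)))
        + B * (g x y + g x' y - 2 * a * g m y))"
      using integrable_g int_gU by auto
    fix y assume y: "y \<in> space \<nu>"
    let ?F = "h (\<psi> y x)" and ?F' = "h (\<psi> y x')"
    have gm: "0 \<le> g m y" using y by (rule g_nonneg)
    have r: "0 \<le> g x y - a * g m y" "0 \<le> g x' y - a * g m y"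
      using overlap[OF y, of x x'] by (auto simp: a_def m_def)
    have FF: "\<bar>?F - ?F'\<bar> \<le> \<rho> * D * (p + q * U y)"
    proof -
      have "\<bar>?F - ?F'\<bar> \<le> dist (\<psi> y x) (\<psi> y x') * (p + q * U y)"
        unfolding U_def by (rule mod)
      also have "\<dots> \<le> \<rho> * D * (p + q * U y)"
        unfolding D_def using contraction[OF y] pq U by (intro mult_right_mono) auto
      finally show ?thesis .
    qed
    have "g x y * ?F - g x' y * ?F'
        = a * g m y * (?F - ?F') + (g x y - a * g m y) * ?F - (g x' y - a * g m y) * ?F'"
      by (simp add: algebra_simps)
    also have "\<bar>\<dots>\<bar> \<le> \<bar>a * g m y * (?F - ?F')\<bar> + \<bar>(g x y - a * g m y) * ?F\<bar> + \<bar>(g x' y - a * g m y) * ?F'\<bar>"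
      by linarith
    also have "\<dots> = a * g m y * \<bar>?F - ?F'\<bar> + (g x y - a * g m y) * \<bar>?F\<bar> + (g x' y - a * g m y) * \<bar>?F'\<bar>"
      using a gm r by (simp add: abs_mult)
    also have "\<dots> \<le> a * g m y * (\<rho> * D * (p + q * U y)) + (g x y - a * g m y) * B + (g x' y - a * g m y) * B"
      using a gm r FF hB by (intro add_mono mult_left_mono) auto
    also have "\<dots> = a * (\<rho> * D * (p * g m y + q * (g m y * U y))) + B * (g x y + g x' y - 2 * a * g m y)"
      by (simp add: algebra_simps)
    finally show "\<bar>g x y * ?F - g x' y * ?F'\<bar>
        \<le> a * (\<rho> * D * (p * g m y + q * (g m y * U y))) + B * (g x y + g x' y - 2 * a * g m y)" .
  qed
  also have "\<dots> = a * (\<rho> * D * (p + q * (\<integral>y. U y \<partial>G m))) + 2 * B * (1 - a)"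
    using integrable_g int_gU integral_g by (simp add: integral_G algebra_simps)
  also have "\<dots> \<le> 1 * (\<rho> * D * (p + q * (w + C))) + 2 * B * (D * w)"
  proof (intro add_mono mult_mono mult_left_mono)
    show "1 - a \<le> D * w" using failure[of x x'] by (simp add: a_def D_def w_def)
    show "0 \<le> \<rho> * D * (p + q * (\<integral>y. U y \<partial>G m))"
      using \<rho> pq U by (auto simp: D_def intro!: mult_nonneg_nonneg add_nonneg_nonneg)
  qed (use a \<rho> pq U_le Bochner_Integration.integral_nonneg[of "G m" U] U B in \<open>auto simp: D_def\<close>)
  finally show ?thesis by (simp add: D_def w_def algebra_simps)
qed

text \<open>The constants are the fixed point of the recursion in \<open>coupling_step\<close>: \<open>q = \<rho> * q + 2 * B\<close> and
\<open>b = \<rho> * b + \<rho> * q * C\<close>. Hence the bound does not deteriorate with \<open>n\<close>.\<close>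

lemma iterate_modulus:
  assumes f: "f \<in> borel_measurable borel" and B: "\<And>x. \<bar>f x\<bar> \<le> B"
    and L: "0 \<le> L" and lip: "\<And>x y. \<bar>f x - f y\<bar> \<le> L * dist x y"
  defines "q \<equiv> 2 * B / (1 - \<rho>)"
  defines "b \<equiv> \<rho> * q * C / (1 - \<rho>)"
  shows "\<bar>(state.T ^^ n) f x - (state.T ^^ n) f x'\<bar> \<le> dist x x' * (L + b + q * W (x, x'))"
proof -
  have "0 \<le> B" using B[of undefined] by simp
  then have q: "0 \<le> q" and b: "0 \<le> b" using \<rho> C by (auto simp: q_def b_def)
  show ?thesis
  proof (induction n arbitrary: x x')
    case 0
    have "\<bar>f x - f x'\<bar> \<le> dist x x' * L" using lip by (simp add: mult.commute)
    also have "\<dots> \<le> dist x x' * (L + b + q * W (x, x'))"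
      using q b W_nonneg by (intro mult_left_mono) (auto simp: add_increasing2)
    finally show ?case by simp
  next
    case (Suc n)
    have "q * (1 - \<rho>) = 2 * B" "b * (1 - \<rho>) = \<rho> * q * C"
      unfolding b_def q_def using \<rho> by auto
    then have q_eq: "\<rho> * q + 2 * B = q" and b_eq: "\<rho> * b + \<rho> * q * C = b"
      by (simp_all add: algebra_simps)
    have "\<bar>(state.T ^^ Suc n) f x - (state.T ^^ Suc n) f x'\<bar>
        \<le> dist x x' * (\<rho> * (L + b) + \<rho> * q * (W (x, x') + C) + 2 * B * W (x, x'))"
      using coupling_step[OF state.iterate_measurable[OF f] state.iterate_bound[OF f B], of "L + b" q n x x']
        Suc L b q by simp
    also have "\<rho> * (L + b) + \<rho> * q * (W (x, x') + C) + 2 * B * W (x, x')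
        = \<rho> * L + (\<rho> * b + \<rho> * q * C) + (\<rho> * q + 2 * B) * W (x, x')"
      by (simp add: algebra_simps)
    also have "\<dots> = \<rho> * L + b + q * W (x, x')" unfolding q_eq b_eq ..
    also have "dist x x' * \<dots> \<le> dist x x' * (L + b + q * W (x, x'))"
      using \<rho> L by (intro mult_left_mono add_right_mono) (auto simp: mult_left_le_one_le)
    finally show ?case .
  qed
qed

lemma iterate_equicontinuous:
  assumes f: "bounded_continuous f" and lip: "\<And>x y. \<bar>f x - f y\<bar> \<le> L * dist x y" and e: "0 < e"
  shows "\<exists>d>0. \<forall>n y. dist x y < d \<longrightarrow> \<bar>(state.T ^^ n) f x - (state.T ^^ n) f y\<bar> < e"
proof -
  obtain B where B: "0 \<le> B" "\<And>x. \<bar>f x\<bar> \<le> B" using f by (metis bounded_continuousE)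
  have lip': "\<bar>f x - f y\<bar> \<le> \<bar>L\<bar> * dist x y" for x y
    using lip[of x y] mult_right_mono[OF abs_ge_self[of L] zero_le_dist[of x y]] by linarith
  define q where "q = 2 * B / (1 - \<rho>)"
  define b where "b = \<rho> * q * C / (1 - \<rho>)"
  have q: "0 \<le> q" and b: "0 \<le> b" using \<rho> C B by (auto simp: q_def b_def)
  obtain \<gamma> w where \<gamma>: "0 < \<gamma>" "\<And>x'. x' \<in> ball x \<gamma> \<Longrightarrow> W (x, x') \<le> w"
    using W_locally_bounded[of x] by blast
  define s where "s = \<bar>L\<bar> + b + q * max 0 w + 1"
  have s: "0 < s" using q b by (auto simp: s_def intro!: add_nonneg_pos add_nonneg_nonneg)
  have "\<bar>(state.T ^^ n) f x - (state.T ^^ n) f y\<bar> < e" if d: "dist x y < min \<gamma> (e / s)" for n y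
  proof -
    have "q * W (x, y) \<le> q * max 0 w"
      using q \<gamma>(2)[of y] d by (intro mult_left_mono) auto
    then have "dist x y * (\<bar>L\<bar> + b + q * W (x, y)) \<le> dist x y * s"
      by (intro mult_left_mono) (auto simp: s_def)
    also have "\<dots> < e" using d s by (simp add: pos_less_divide_eq)
    finally show ?thesis
      using iterate_modulus[OF bounded_continuous_borel_measurable[OF f] B(2) abs_ge_zero lip', of n x y]
      unfolding q_def b_def by linarith
  qed
  then show ?thesis using \<gamma>(1) e s by (intro exI[of _ "min \<gamma> (e / s)"]) auto
qed

end

section \<open>The stationary distribution\<close>

theorem theorem4:
  fixes \<nu> :: "'b measure"
    and g :: "'a :: polish_space \<Rightarrow> 'b \<Rightarrow> real"
    and \<psi> :: "'b \<Rightarrow> 'a \<Rightarrow> 'a"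
    and V :: "'a \<Rightarrow> real"
    and lam \<beta> :: real
    and \<alpha> :: "'a \<times> 'a \<Rightarrow> real"
    and \<phi> :: "'a \<times> 'a \<Rightarrow> 'a"
    and W :: "'a \<times> 'a \<Rightarrow> real"
  defines "G \<equiv> obs_kernel \<nu> g"
    and "K \<equiv> joint_kernel \<nu> g \<psi>"
    and "R \<equiv> state_kernel \<nu> g \<psi>"
  assumes model: "dominated_observation_driven_model \<nu> g \<psi>"
    and a: "locally compact (UNIV :: 'a set)"
    and b_const: "0 < lam" "lam < 1" "0 \<le> \<beta>"
    and b_V: "V \<in> borel_measurable borel" "\<And>x. 0 \<le> V x"
    and b_drift: "\<And>x. (\<integral>\<^sup>+x'. ennreal (V x') \<partial>R x) \<le> ennreal (lam * V x + \<beta>)"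
    and b_compact: "\<And>M. 0 < M \<Longrightarrow> compact {x. V x \<le> M}"
    and c: "weak_feller R"
    and d: "\<exists>x\<^sub>0. reachable_point R x\<^sub>0"
    and e: "(SUP (x, x', y) \<in> {(x, x', y). y \<in> space \<nu> \<and> x \<noteq> x'}.
               ennreal (dist (\<psi> y x) (\<psi> y x') / dist x x')) < 1"
    and f_\<alpha>: "\<alpha> \<in> borel_measurable (borel \<Otimes>\<^sub>M borel)" "\<And>p. \<alpha> p \<in> {0..1}"
    and f_\<phi>: "\<phi> \<in> borel \<Otimes>\<^sub>M borel \<rightarrow>\<^sub>M borel"
    and f_W: "W \<in> borel_measurable (borel \<Otimes>\<^sub>M borel)" "\<And>p. 1 \<le> W p"
    and f_i: "\<And>x x' y. y \<in> space \<nu> \<Longrightarrow> min (g x y) (g x' y) \<ge> \<alpha> (x, x') * g (\<phi> (x, x')) y"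
    and f_ii: "\<And>x. \<exists>\<gamma>>0. (SUP x' \<in> ball x \<gamma>. ereal (W (x, x'))) < \<infinity>"
    and f_iii: "\<And>x x'. 1 - \<alpha> (x, x') \<le> dist x x' * W (x, x')"
    and f_iv: "(SUP (x, x').
                  enn2ereal (\<integral>\<^sup>+y. ennreal (W (\<psi> y x, \<psi> y x')) \<partial>G (\<phi> (x, x'))) - ereal (W (x, x')))
               < \<infinity>"
  shows "(\<exists>!\<pi>. stationary_distribution (borel \<Otimes>\<^sub>M \<nu>) K \<pi>) \<and>
    (\<forall>\<pi>. stationary_distribution (borel \<Otimes>\<^sub>M \<nu>) K \<pi> \<longrightarrow>
       (\<forall>Vbar \<in> borel_measurable borel. (\<forall>x. 0 \<le> Vbar x) \<and> Vbar \<lesssim> V \<longrightarrow>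
          (\<integral>\<^sup>+x. ennreal (Vbar x) \<partial>distr \<pi> borel fst) < \<infinity>))"
proof -
  interpret dominated_observation_driven_model \<nu> g \<psi> by (rule model)
  define S where "S = (SUP (x, x', y) \<in> {(x, x', y). y \<in> space \<nu> \<and> x \<noteq> x'}.
               ennreal (dist (\<psi> y x) (\<psi> y x') / dist x x'))"
  define \<rho> where "\<rho> = enn2real S"
  have S: "S < 1" using e by (simp add: S_def)
  then have S_eq: "S = ennreal \<rho>" unfolding \<rho>_def by (simp add: less_top order_less_trans[OF _ ennreal_one_less_top])
  have \<rho>: "0 \<le> \<rho>" "\<rho> < 1" using S unfolding S_eq by (auto simp: \<rho>_def ennreal_less_one_iff)
  have contraction: "dist (\<psi> y x) (\<psi> y x') \<le> \<rho> * dist x x'" if "y \<in> space \<nu>" for x x' y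
  proof (cases "x = x'")
    case False
    have "ennreal (dist (\<psi> y x) (\<psi> y x') / dist x x') \<le> ennreal \<rho>"
      unfolding S_eq[symmetric] S_def using False that by (intro SUP_upper2[of "(x, x', y)"]) auto
    then show ?thesis using False \<rho>(1) by (simp add: pos_divide_le_eq)
  qed simp
  define Q where "Q = (SUP (x, x').
      enn2ereal (\<integral>\<^sup>+y. ennreal (W (\<psi> y x, \<psi> y x')) \<partial>G (\<phi> (x, x'))) - ereal (W (x, x')))"
  \<comment> \<open>The supremum can be negative, but only a nonnegative \<open>C\<close> keeps the constants above nonnegative.\<close>
  define C where "C = max 0 (real_of_ereal Q)"
  have "Q \<le> ereal C"
    using f_iv unfolding C_def Q_def[symmetric] by (cases Q) auto
  have W_drift: "(\<integral>\<^sup>+y. ennreal (W (\<psi> y x, \<psi> y x')) \<partial>G (\<phi> (x, x'))) \<le> ennreal (W (x, x') + C)" for x x'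
  proof -
    have "enn2ereal (\<integral>\<^sup>+y. ennreal (W (\<psi> y x, \<psi> y x')) \<partial>G (\<phi> (x, x'))) - ereal (W (x, x')) \<le> Q"
      unfolding Q_def by (intro SUP_upper2[of "(x, x')"]) auto
    then have "enn2ereal (\<integral>\<^sup>+y. ennreal (W (\<psi> y x, \<psi> y x')) \<partial>G (\<phi> (x, x'))) - ereal (W (x, x')) \<le> ereal C"
      using \<open>Q \<le> ereal C\<close> by (rule order_trans)
    then have "enn2ereal (\<integral>\<^sup>+y. ennreal (W (\<psi> y x, \<psi> y x')) \<partial>G (\<phi> (x, x'))) \<le> ereal (W (x, x') + C)"
      by (subst (asm) ereal_minus_le) (auto simp: add.commute)
    moreover have "0 \<le> W (x, x') + C" using f_W(2)[of "(x, x')"] by (simp add: C_def)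
    ultimately show ?thesis by (simp add: less_eq_ennreal.rep_eq enn2ereal_ennreal)
  qed
  have W_loc: "\<exists>\<gamma>>0. \<exists>w. \<forall>x'\<in>ball x \<gamma>. W (x, x') \<le> w" for x
  proof -
    obtain \<gamma> where \<gamma>: "0 < \<gamma>" "(SUP x' \<in> ball x \<gamma>. ereal (W (x, x'))) < \<infinity>" using f_ii by blast
    then obtain w where w: "(SUP x' \<in> ball x \<gamma>. ereal (W (x, x'))) < ereal w"
      using ereal_dense2 by blast
    have "W (x, x') \<le> w" if "x' \<in> ball x \<gamma>" for x'
    proof -
      have "ereal (W (x, x')) \<le> ereal w"
        using SUP_upper[OF that, of "\<lambda>x'. ereal (W (x, x'))"] w by (meson less_imp_le order_trans)
      then show ?thesis by simp
    qed
    with \<gamma>(1) show ?thesis by blast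
  qed
  interpret coupled: coupled_observation_model \<nu> g \<psi> \<rho> C \<alpha> W \<phi>
    using \<rho> contraction f_\<alpha>(2) f_W f_i f_iii W_drift W_loc
    by unfold_locales (auto simp: C_def G_def)
  interpret state: feller_drift_kernel "state_kernel \<nu> g \<psi>" V lam \<beta>
    using b_const b_V b_drift b_compact c
    by unfold_locales (auto simp: R_def)
  obtain x\<^sub>0 where x0: "reachable_point (state_kernel \<nu> g \<psi>) x\<^sub>0" using d unfolding R_def by blast
  obtain \<mu> where \<mu>: "stationary_distribution borel (state_kernel \<nu> g \<psi>) \<mu>"
    using state.stationary_exists by blast
  have uniq: "\<mu>' = \<mu>" if "stationary_distribution borel (state_kernel \<nu> g \<psi>) \<mu>'" for \<mu>'
    using state.stationary_unique[OF x0 coupled.iterate_equicontinuous that \<mu>] .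
  show ?thesis
  proof (intro conjI allI impI ballI ex1I[of _ "\<mu> \<bind> pair_kernel"])
    show "stationary_distribution (borel \<Otimes>\<^sub>M \<nu>) K (\<mu> \<bind> pair_kernel)"
      unfolding K_def by (rule stationary_joint_of_state[OF \<mu>])
    fix \<pi> assume "stationary_distribution (borel \<Otimes>\<^sub>M \<nu>) K \<pi>"
    then have \<pi>: "stationary_distribution borel (state_kernel \<nu> g \<psi>) (distr \<pi> borel fst)"
      "\<pi> = distr \<pi> borel fst \<bind> pair_kernel"
      unfolding K_def by (rule stationary_joint_imp)+
    show "\<pi> = \<mu> \<bind> pair_kernel"
      using \<pi> uniq by metis
    fix Vbar :: "'a \<Rightarrow> real"
    assume "Vbar \<in> borel_measurable borel" "(\<forall>x. 0 \<le> Vbar x) \<and> Vbar \<lesssim> V"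
    then obtain k where k: "0 < k" "\<And>x. Vbar x \<le> k * V x"
      unfolding lesssim_def by (metis abs_of_nonneg)
    have "(\<integral>\<^sup>+x. ennreal (Vbar x) \<partial>distr \<pi> borel fst) \<le> (\<integral>\<^sup>+x. ennreal k * ennreal (V x) \<partial>distr \<pi> borel fst)"
      using k b_V(2) by (intro nn_integral_mono) (simp flip: ennreal_mult'')
    also have "\<dots> = ennreal k * (\<integral>\<^sup>+x. ennreal (V x) \<partial>distr \<pi> borel fst)"
      using b_V(1) by (intro nn_integral_cmult) simp
    also have "\<dots> \<le> ennreal k * ennreal state.level"
      by (intro mult_left_mono state.stationary_V \<pi>) simp
    also have "\<dots> < \<infinity>" by (simp add: ennreal_mult_less_top)
    finally show "(\<integral>\<^sup>+x. ennreal (Vbar x) \<partial>distr \<pi> borel fst) < \<infinity>" .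
  qed
qed

end
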